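(* Let $1\le p\le\infty$, let $E$ and $F$ be Banach spaces and $T\colon E\to F$ a bounded linear operator. Then $T$ is $p$-compact if and only if there exist Banach spaces $X,Y$, compact operators $R\colon E\to X$ and $S\colon Y\to F$, and a $p$-compact operator $T_0\colon X\to Y$ such that $T=ST_0R$. Moreover, in this case $\kappa_p(T)=\inf\{\|S\|\,\kappa_p(T_0)\,\|R\|\}$, where the infimum is taken over all such factorizations.
   Context: For a Banach space $E$ and $1\le p<\infty$, $\ell_p(E)$ is the space of sequences $(x_n)_n$ in $E$ with $\|(x_n)_n\|_p=(\sum_n\|x_n\|^p)^{1/p}<\infty$; for $p=\infty$ it is replaced by $c_0(E)$ with the supremum norm. With $\frac1p+\frac1{p'}=1$, for $(x_n)_n\in\ell_p(E)$ put $p\text{-}\mathrm{co}\{x_n\}=\{\sum_{n=1}^\infty\alpha_nx_n:(\alpha_n)_n\in B_{\ell_{p'}}\}$, where $\ell_{p'}$ is replaced by $c_0$ if $p=1$. A bounded operator $T\colon E\to F$ is $p$-compact if $T(B_E)\subset p\text{-}\mathrm{co}\{x_n\}$ for some $(x_n)_n\in\ell_p(F)$, and $\kappa_p(T)=\inf\{\|(x_n)_n\|_p: T(B_E)\subset p\text{-}\mathrm{co}\{x_n\}\}$. *)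

theory Defs
  imports "HOL-Analysis.Analysis" "HOL-Algebra.Module"
begin

text \<open>
  The statement quantifies existentially over Banach spaces, which cannot be done with the
  type class \<open>banach\<close>. Banach spaces are therefore structures with an explicit carrier: a
  HOL-Algebra module together with a norm. As usual for modules in HOL-Algebra, the inherited
  ring fields \<open>mult\<close> and \<open>one\<close> of the record are not used.

  The scalar type \<open>'k\<close> is only assumed to be a normed field that is a finite-dimensional
  Euclidean space over the reals, so that \<open>'k = real\<close> and \<open>'k = complex\<close> are both covered.
\<close>

record ('k, 'a) normed_module = "('k, 'a) module" +
  vnorm :: "'a \<Rightarrow> real"

text \<open>The scalar field, both as the ring of scalars and as a one-dimensional normed space.\<close>

definition scalars :: "('k::real_normed_field, 'k) normed_module" where
  "scalars = \<lparr>carrier = UNIV, mult = (*), one = 1, zero = 0, add = (+),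
              smult = (*), vnorm = norm\<rparr>"

text \<open>The value off the carrier is fixed to be 0 because the locale \<open>Metric_space\<close> demands
  symmetry and nonnegativity there, too.\<close>

definition vdist :: "('k, 'a) normed_module \<Rightarrow> 'a \<Rightarrow> 'a \<Rightarrow> real" where
  "vdist E x y =
    (if x \<in> carrier E \<and> y \<in> carrier E then vnorm E (x \<ominus>\<^bsub>E\<^esub> y) else 0)"

abbreviation vtopology :: "('k, 'a) normed_module \<Rightarrow> 'a topology" where
  "vtopology E \<equiv> Metric_space.mtopology (carrier E) (vdist E)"

locale normed_space = module scalars E
  for E :: "('k::{real_normed_field,euclidean_space}, 'a) normed_module" (structure) +
  assumes vnorm_eq_0: "x \<in> carrier E \<Longrightarrow> vnorm E x = 0 \<longleftrightarrow> x = \<zero>"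
    and vnorm_triangle:
      "\<lbrakk>x \<in> carrier E; y \<in> carrier E\<rbrakk> \<Longrightarrow> vnorm E (x \<oplus> y) \<le> vnorm E x + vnorm E y"
    and vnorm_smult: "x \<in> carrier E \<Longrightarrow> vnorm E (a \<odot> x) = norm a * vnorm E x"

locale banach_space = normed_space +
  assumes complete: "Metric_space.mcomplete (carrier E) (vdist E)"

definition unit_ball :: "('k, 'a) normed_module \<Rightarrow> 'a set" where
  "unit_ball E = {x \<in> carrier E. vnorm E x \<le> 1}"

definition vsums :: "('k, 'a) normed_module \<Rightarrow> (nat \<Rightarrow> 'a) \<Rightarrow> 'a \<Rightarrow> bool" where
  "vsums E x s \<longleftrightarrow>
    limitin (vtopology E) (\<lambda>N. finsum E x {..<N}) s sequentially"


text \<open>The space \<open>\<ell>\<^sub>p(E)\<close>, with the convention that it stands for \<open>c\<^sub>0(E)\<close> if \<open>p = \<infinity>\<close>.\<close>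

definition lp :: "ereal \<Rightarrow> ('k, 'a) normed_module \<Rightarrow> (nat \<Rightarrow> 'a) set" where
  "lp p E = {x. (\<forall>n. x n \<in> carrier E) \<and>
     (if p = \<infinity> then (\<lambda>n. vnorm E (x n)) \<longlonglongrightarrow> 0
      else summable (\<lambda>n. vnorm E (x n) powr real_of_ereal p))}"

definition lp_norm :: "ereal \<Rightarrow> ('k, 'a) normed_module \<Rightarrow> (nat \<Rightarrow> 'a) \<Rightarrow> real" where
  "lp_norm p E x =
     (if p = \<infinity> then (SUP n. vnorm E (x n))
      else (\<Sum>n. vnorm E (x n) powr real_of_ereal p) powr (1 / real_of_ereal p))"

text \<open>In \<open>ereal\<close> we have \<open>inverse \<infinity> = 0\<close> and \<open>inverse 0 = \<infinity>\<close>, so this solves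
  \<open>1/p + 1/p' = 1\<close> on all of \<open>[1,\<infinity>]\<close>, see \<open>conj_exp\<close> below.\<close>

definition conj_exp :: "ereal \<Rightarrow> ereal" where
  "conj_exp p = inverse (1 - inverse p)"

text \<open>For \<open>p = 1\<close> the coefficients are taken from \<open>c\<^sub>0\<close>, as \<open>conj_exp 1 = \<infinity>\<close>.\<close>

definition p_co :: "ereal \<Rightarrow> ('k::real_normed_field, 'a) normed_module \<Rightarrow> (nat \<Rightarrow> 'a) \<Rightarrow> 'a set"
  where
  "p_co p E x = {s. \<exists>\<alpha> \<in> lp (conj_exp p) (scalars :: ('k, 'k) normed_module).
     lp_norm (conj_exp p) (scalars :: ('k, 'k) normed_module) \<alpha> \<le> 1 \<and>
     vsums E (\<lambda>n. \<alpha> n \<odot>\<^bsub>E\<^esub> x n) s}"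


text \<open>Operators are functions of which only the values on the carrier of the domain matter.\<close>

definition bounded_operator ::
  "('k, 'a) normed_module \<Rightarrow> ('k, 'b) normed_module \<Rightarrow> ('a \<Rightarrow> 'b) \<Rightarrow> bool" where
  "bounded_operator E F T \<longleftrightarrow>
     T \<in> carrier E \<rightarrow> carrier F \<and>
     (\<forall>x\<in>carrier E. \<forall>y\<in>carrier E. T (x \<oplus>\<^bsub>E\<^esub> y) = T x \<oplus>\<^bsub>F\<^esub> T y) \<and>
     (\<forall>a. \<forall>x\<in>carrier E. T (a \<odot>\<^bsub>E\<^esub> x) = a \<odot>\<^bsub>F\<^esub> T x) \<and>
     (\<exists>C. \<forall>x\<in>carrier E. vnorm F (T x) \<le> C * vnorm E x)"

definition op_norm ::
  "('k, 'a) normed_module \<Rightarrow> ('k, 'b) normed_module \<Rightarrow> ('a \<Rightarrow> 'b) \<Rightarrow> real" where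
  "op_norm E F T = (SUP x\<in>unit_ball E. vnorm F (T x))"

definition compact_operator ::
  "('k, 'a) normed_module \<Rightarrow> ('k, 'b) normed_module \<Rightarrow> ('a \<Rightarrow> 'b) \<Rightarrow> bool" where
  "compact_operator E F T \<longleftrightarrow> bounded_operator E F T \<and>
     compactin (vtopology F) (vtopology F closure_of (T ` unit_ball E))"

definition p_compact_operator ::
  "ereal \<Rightarrow> ('k::real_normed_field, 'a) normed_module \<Rightarrow> ('k, 'b) normed_module \<Rightarrow>
   ('a \<Rightarrow> 'b) \<Rightarrow> bool" where
  "p_compact_operator p E F T \<longleftrightarrow> bounded_operator E F T \<and>
     (\<exists>x \<in> lp p F. T ` unit_ball E \<subseteq> p_co p F x)"

definition kappa ::
  "ereal \<Rightarrow> ('k::real_normed_field, 'a) normed_module \<Rightarrow> ('k, 'b) normed_module \<Rightarrow>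
   ('a \<Rightarrow> 'b) \<Rightarrow> real" where
  "kappa p E F T = Inf {lp_norm p F x | x. x \<in> lp p F \<and> T ` unit_ball E \<subseteq> p_co p F x}"

text \<open>\<open>T = S T\<^sub>0 R\<close> with \<open>R: E \<rightarrow> X\<close>, \<open>T\<^sub>0: X \<rightarrow> Y\<close>, \<open>S: Y \<rightarrow> F\<close> as in the theorem.\<close>

definition compact_factorization ::
  "ereal \<Rightarrow> ('k::{real_normed_field,euclidean_space}, 'e) normed_module \<Rightarrow>
   ('k, 'f) normed_module \<Rightarrow> ('e \<Rightarrow> 'f) \<Rightarrow>
   ('k, 'x) normed_module \<Rightarrow> ('k, 'y) normed_module \<Rightarrow>
   ('e \<Rightarrow> 'x) \<Rightarrow> ('x \<Rightarrow> 'y) \<Rightarrow> ('y \<Rightarrow> 'f) \<Rightarrow> bool" where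
  "compact_factorization p E F T X Y R T\<^sub>0 S \<longleftrightarrow>
     banach_space X \<and> banach_space Y \<and>
     compact_operator E X R \<and> p_compact_operator p X Y T\<^sub>0 \<and> compact_operator Y F S \<and>
     (\<forall>x\<in>carrier E. T x = S (T\<^sub>0 (R x)))"


lemma conj_exp:
  assumes "1 \<le> p"
  shows "inverse p + inverse (conj_exp p) = 1" "1 \<le> conj_exp p"
proof -
  have "inverse p + inverse (conj_exp p) = 1 \<and> 1 \<le> conj_exp p"
  proof (cases p)
    case (real r)
    with assms have r: "1 \<le> r" by simp
    show ?thesis
    proof (cases "r = 1")
      case True
      with real show ?thesis by (simp add: conj_exp_def flip: one_ereal_def)
    next
      case False
      with r have "0 < 1 - inverse r" "1 - inverse r \<le> 1"
        by (simp_all add: field_simps)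
      with r real show ?thesis
        by (auto simp: conj_exp_def one_ereal_def one_le_inverse_iff)
    qed
  qed (use assms in \<open>auto simp: conj_exp_def\<close>)
  then show "inverse p + inverse (conj_exp p) = 1" "1 \<le> conj_exp p" by auto
qed

lemma cring_scalars: "cring (scalars :: ('k::real_normed_field, 'k) normed_module)"
  by (rule cringI, rule abelian_groupI, rule_tac [7] comm_monoidI)
    (auto simp: scalars_def algebra_simps intro: exI[of _ "- x" for x])

context normed_space
begin

lemma vnorm_zero [simp]: "vnorm E \<zero> = 0"
  by (simp add: vnorm_eq_0)

lemma vnorm_uminus:
  assumes "x \<in> carrier E" shows "vnorm E (\<ominus> x) = vnorm E x"
proof -
  have "\<ominus>\<^bsub>scalars\<^esub> \<one>\<^bsub>scalars\<^esub> = (- 1 :: 'k)"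
    by (rule R.minus_equality) (auto simp: scalars_def)
  then have "\<ominus> x = (- 1) \<odot> x"
    using smult_l_minus[of "\<one>\<^bsub>scalars\<^esub>" x] assms by simp
  then show ?thesis
    using assms by (simp add: vnorm_smult)
qed

lemma vnorm_nonneg: "x \<in> carrier E \<Longrightarrow> 0 \<le> vnorm E x"
  using vnorm_triangle[of x "\<ominus> x"] by (simp add: vnorm_uminus M.r_neg)

sublocale Metric_space "carrier E" "vdist E"
proof
  show "0 \<le> vdist E x y" for x y
    by (auto simp: vdist_def intro: vnorm_nonneg)
  show "vdist E x y = vdist E y x" for x y
    using vnorm_uminus[of "x \<ominus> y"]
    by (auto simp: vdist_def M.minus_eq M.minus_add M.a_comm)
  show "vdist E x y = 0 \<longleftrightarrow> x = y" if "x \<in> carrier E" "y \<in> carrier E" for x y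
  proof -
    have "x \<ominus> y = \<zero> \<longleftrightarrow> x = y"
      using that
      by (metis M.add.inv_closed M.minus_eq M.minus_equality M.minus_minus M.r_neg)
    then show ?thesis
      using that by (simp add: vdist_def vnorm_eq_0)
  qed
  show "vdist E x z \<le> vdist E x y + vdist E y z"
    if "x \<in> carrier E" "y \<in> carrier E" "z \<in> carrier E" for x y z
  proof -
    have "x \<ominus> z = (x \<ominus> y) \<oplus> (y \<ominus> z)"
      using that by (simp add: M.minus_eq M.a_assoc M.r_neg2 M.r_neg1)
    then show ?thesis
      using that vnorm_triangle[of "x \<ominus> y" "y \<ominus> z"] by (simp add: vdist_def)
  qed
qed

end

lemma banach_space_scalars:
  "banach_space (scalars :: ('k::{real_normed_field,euclidean_space}, 'k) normed_module)"
proof -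
  interpret cring "scalars :: ('k, 'k) normed_module" by (rule cring_scalars)
  interpret normed_space "scalars :: ('k, 'k) normed_module"
    by unfold_locales (auto simp: scalars_def algebra_simps norm_mult norm_triangle_ineq)
  have neg: "\<ominus>\<^bsub>scalars\<^esub> y = - y" for y :: 'k
    by (rule minus_equality) (auto simp: scalars_def)
  have "vdist (scalars :: ('k, 'k) normed_module) = dist"
    unfolding vdist_def fun_eq_iff a_minus_def neg by (simp add: scalars_def dist_norm)
  moreover have "carrier (scalars :: ('k, 'k) normed_module) = UNIV"
    by (simp add: scalars_def)
  ultimately show ?thesis
    by unfold_locales (simp add: complete_UNIV)
qed

end

theory Submission
  imports Defs
begin

text \<open>
  Let \<open>T\<close> map the unit ball into \<open>p\<close>-co of \<open>x \<in> \<ell>\<^sub>p(F)\<close>. A null sequence \<open>\<lambda>\<close> can be split off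
  the norms of \<open>x\<close> at the cost of a factor close to 1, which gives \<open>x\<^sub>n = \<mu>\<^sub>n \<sigma>\<^sub>n \<mu>\<^sub>n v\<^sub>n\<close> with
  \<open>\<mu>\<^sub>n\<close> the square root of \<open>\<lambda>\<^sub>n\<close>, with \<open>\<sigma> \<in> \<ell>\<^sub>p\<close> and with \<open>v\<^sub>n\<close> in the unit ball of \<open>F\<close>.
  On sequence spaces, \<open>T\<close> is then the composition of the diagonal operators
  \<open>\<mu>: \<ell>\<^sub>p\<^sub>' \<rightarrow> \<ell>\<^sub>p\<^sub>'\<close> (compact), \<open>\<sigma>: \<ell>\<^sub>p\<^sub>' \<rightarrow> \<ell>\<^sub>1\<close> (\<open>p\<close>-compact by Hoelder's inequality),
  \<open>\<mu>: \<ell>\<^sub>1 \<rightarrow> \<ell>\<^sub>1\<close> (compact) and the summation operator \<open>\<ell>\<^sub>1 \<rightarrow> F\<close> given by \<open>v\<close>.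
  Since the coefficients of \<open>T z\<close> are not unique, \<open>X\<close> and \<open>Y\<close> have to be the quotients of
  \<open>\<ell>\<^sub>p\<^sub>'\<close> and \<open>\<ell>\<^sub>1\<close> by the kernels of the respective maps to \<open>F\<close>. The converse, and the lower
  bound for the infimum, is the ideal property of \<open>p\<close>-compact operators.
\<close>

section \<open>Scalar sequences\<close>

text \<open>Both outer operators must be compact, so each needs a null multiplier of its own. The
  two square roots supply one each and leave all of the p-summability to \<sigma>. Thus the outer
  norms stay at most 1 and the middle operator carries kappa_p up to a factor close to 1, as the
  infimum formula requires. \<open>R\<close> has to be linear although a choice of coefficients is
  not; modulo the kernel, the coefficients of T z become unique. The first quotient forces the
  second: \<sigma> maps the kernel in l_p' into the kernel in l_1, but not to 0, so
  \<open>T\<^sub>0\<close> is well defined only if l_1 is divided as well. The constant close to 1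
  is spent twice, once on splitting off the null sequence and once because a quotient norm is an
  infimum that may not be attained. The intermediate spaces must live on types given in advance,
  whereas cosets would form a type of their own. Each class is therefore replaced by the injective
  image of one representative; this is where the cardinality of the continuum enters.\<close>

definition lseq :: "ereal \<Rightarrow> (nat \<Rightarrow> real) \<Rightarrow> bool" where
  "lseq p a \<longleftrightarrow> (\<forall>n. 0 \<le> a n) \<and>
     (if p = \<infinity> then a \<longlonglongrightarrow> 0 else summable (\<lambda>n. a n powr real_of_ereal p))"

text \<open>Vector-valued and scalar sequences enter \<open>lp\<close> and \<open>lp_norm\<close>
  only through their norms, so the estimates are proved once, for nonnegative real
  sequences.\<close>

definition lseq_norm :: "ereal \<Rightarrow> (nat \<Rightarrow> real) \<Rightarrow> real" where
  "lseq_norm p a =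
     (if p = \<infinity> then (SUP n. a n)
      else (\<Sum>n. a n powr real_of_ereal p) powr (1 / real_of_ereal p))"

lemma lseq_nonneg: "lseq p a \<Longrightarrow> 0 \<le> a n"
  by (simp add: lseq_def)

lemma ereal_ge_1_cases:
  assumes "1 \<le> p"
  obtains r where "p = ereal r" "1 \<le> r" | "p = \<infinity>"
  using assms by (cases p) auto

lemma lseq_real: "lseq (ereal r) a \<longleftrightarrow> (\<forall>n. 0 \<le> a n) \<and> summable (\<lambda>n. a n powr r)"
  by (simp add: lseq_def)

lemma lseq_PInf: "lseq \<infinity> a \<longleftrightarrow> (\<forall>n. 0 \<le> a n) \<and> a \<longlonglongrightarrow> 0"
  by (simp add: lseq_def)

text \<open>Summability and the norm bound both come from one estimate of finite sums, which is how
  all finite exponents are treated below.\<close>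

lemma lseq_realI:
  assumes "1 \<le> r" "\<And>n. 0 \<le> a n" "0 \<le> C" "\<And>N. (\<Sum>n<N. a n powr r) \<le> C powr r"
  shows "lseq (ereal r) a" "lseq_norm (ereal r) a \<le> C"
proof -
  have s: "summable (\<lambda>n. a n powr r)"
    by (rule summableI_nonneg_bounded[where x="C powr r"]) (use assms in auto)
  then show "lseq (ereal r) a" using assms by (simp add: lseq_real)
  have "(\<Sum>n. a n powr r) \<le> C powr r"
    by (rule suminf_le_const[OF s]) (use assms in auto)
  then have "(\<Sum>n. a n powr r) powr (1/r) \<le> (C powr r) powr (1/r)"
    using assms s by (intro powr_mono2) (auto intro: suminf_nonneg)
  also have "\<dots> = C" using assms by (simp add: powr_powr)
  finally show "lseq_norm (ereal r) a \<le> C" by (simp add: lseq_norm_def)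
qed

lemma lseq_PInf_le_norm:
  assumes "lseq \<infinity> a" shows "a n \<le> lseq_norm \<infinity> a"
proof -
  have "Bseq a" using assms by (auto simp: lseq_PInf intro!: convergent_imp_Bseq convergentI)
  then have "bdd_above (range a)" by (simp add: Bseq_eq_bounded bounded_imp_bdd_above)
  then show ?thesis by (simp add: lseq_norm_def cSUP_upper)
qed

lemma lseq_PInf_norm_le:
  assumes "\<And>n. a n \<le> C" shows "lseq_norm \<infinity> a \<le> C"
  using assms by (simp add: lseq_norm_def cSUP_least)

lemma lseq_norm_nonneg:
  assumes "lseq p a" shows "0 \<le> lseq_norm p a"
proof (cases "p = \<infinity>")
  case True
  then show ?thesis using lseq_PInf_le_norm[of a 0] lseq_nonneg[OF assms, of 0] assms by auto
qed (simp add: lseq_norm_def)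

lemma lseq_norm_powr:
  assumes "1 \<le> r" "lseq (ereal r) a"
  shows "lseq_norm (ereal r) a powr r = (\<Sum>n. a n powr r)"
proof -
  have "0 \<le> (\<Sum>n. a n powr r)" using assms by (auto intro: suminf_nonneg simp: lseq_real)
  then show ?thesis using assms by (simp add: lseq_norm_def powr_powr)
qed

lemma lseq_sum_le:
  assumes "1 \<le> r" "lseq (ereal r) a" "finite I"
  shows "(\<Sum>n\<in>I. a n powr r) \<le> lseq_norm (ereal r) a powr r"
  unfolding lseq_norm_powr[OF assms(1,2)]
  using assms by (intro sum_le_suminf) (auto simp: lseq_real)

lemma lseq_le_norm:
  assumes "1 \<le> p" "lseq p a" shows "a n \<le> lseq_norm p a"
  using assms(1)
proof (cases rule: ereal_ge_1_cases)
  case (1 r)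
  have "a n powr r \<le> lseq_norm p a powr r"
    using lseq_sum_le[of r a "{n}"] assms 1 by simp
  then have "(a n powr r) powr (1/r) \<le> (lseq_norm p a powr r) powr (1/r)"
    using 1 by (intro powr_mono2[of "1/r"]) auto
  then show ?thesis
    using 1 lseq_nonneg[OF assms(2)] lseq_norm_nonneg[OF assms(2)] by (simp add: powr_powr)
next
  case 2 then show ?thesis using assms lseq_PInf_le_norm by auto
qed

lemma lseq_mono:
  assumes "1 \<le> p" "lseq p b" "\<And>n. 0 \<le> a n" "\<And>n. a n \<le> b n"
  shows "lseq p a" "lseq_norm p a \<le> lseq_norm p b"
proof -
  have "lseq p a \<and> lseq_norm p a \<le> lseq_norm p b"
    using assms(1)
  proof (cases rule: ereal_ge_1_cases)
    case (1 r)
    have "(\<Sum>n<N. a n powr r) \<le> lseq_norm p b powr r" for N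
    proof -
      have "(\<Sum>n<N. a n powr r) \<le> (\<Sum>n<N. b n powr r)"
        using assms 1 by (intro sum_mono powr_mono2) auto
      also have "\<dots> \<le> lseq_norm p b powr r" using lseq_sum_le 1 assms by simp
      finally show ?thesis .
    qed
    then show ?thesis
      using lseq_realI[of r a "lseq_norm p b"] assms 1 lseq_norm_nonneg by auto
  next
    case 2
    have "a \<longlonglongrightarrow> 0"
      by (rule tendsto_sandwich[OF _ _ tendsto_const[of 0]])
         (use assms 2 in \<open>auto simp: lseq_PInf\<close>)
    moreover have "a n \<le> lseq_norm p b" for n
      using lseq_le_norm[OF assms(1,2), of n] assms(4)[of n] by simp
    ultimately show ?thesis using 2 assms lseq_PInf_norm_le by (auto simp: lseq_PInf)
  qed
  then show "lseq p a" "lseq_norm p a \<le> lseq_norm p b" by auto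
qed

lemma lseq_scale:
  assumes "1 \<le> p" "lseq p a" "0 \<le> c"
  shows "lseq p (\<lambda>n. c * a n)" "lseq_norm p (\<lambda>n. c * a n) = c * lseq_norm p a"
proof -
  have *: "lseq p (\<lambda>n. c * b n) \<and> lseq_norm p (\<lambda>n. c * b n) \<le> c * lseq_norm p b"
    if b: "lseq p b" and c: "0 \<le> c" for b c
    using assms(1)
  proof (cases rule: ereal_ge_1_cases)
    case (1 r)
    have "(\<Sum>n<N. (c * b n) powr r) \<le> (c * lseq_norm p b) powr r" for N
    proof -
      have "(\<Sum>n<N. (c * b n) powr r) = c powr r * (\<Sum>n<N. b n powr r)"
        using c lseq_nonneg[OF b] by (simp add: powr_mult sum_distrib_left)
      also have "\<dots> \<le> c powr r * lseq_norm p b powr r"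
        using lseq_sum_le[of r b "{..<N}"] 1 b by (intro mult_left_mono) auto
      finally show ?thesis using c lseq_norm_nonneg[OF b] by (simp add: powr_mult)
    qed
    then show ?thesis
      using lseq_realI[of r "\<lambda>n. c * b n" "c * lseq_norm p b"] 1 b c lseq_norm_nonneg[OF b]
        lseq_nonneg[OF b] by auto
  next
    case 2
    have "(\<lambda>n. c * b n) \<longlonglongrightarrow> 0"
      using b 2 tendsto_mult_left[of b 0 sequentially c] by (simp add: lseq_PInf)
    moreover have "c * b n \<le> c * lseq_norm p b" for n
      using lseq_le_norm[OF assms(1) b, of n] c by (simp add: mult_left_mono)
    ultimately show ?thesis using 2 c lseq_nonneg[OF b] lseq_PInf_norm_le by (auto simp: lseq_PInf)
  qed
  from * assms show l: "lseq p (\<lambda>n. c * a n)" by auto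
  show "lseq_norm p (\<lambda>n. c * a n) = c * lseq_norm p a"
  proof (cases "c = 0")
    case True
    then show ?thesis using *[OF assms(2,3)] lseq_norm_nonneg[OF l] by auto
  next
    case False
    \<comment> \<open>Equality follows from the inequality \<open>*\<close> applied to the scaled
      sequence and the factor 1/c.\<close>
    then have "lseq_norm p a \<le> inverse c * lseq_norm p (\<lambda>n. c * a n)"
      using *[OF l, of "inverse c"] assms(3) by (simp flip: mult.assoc)
    then show ?thesis using *[OF assms(2,3)] False assms(3) by (simp add: field_simps)
  qed
qed

lemma lseq_zero: "lseq p (\<lambda>n. 0)" "lseq_norm p (\<lambda>n. 0) = 0"
  by (auto simp: lseq_def lseq_norm_def)

section \<open>Minkowski's and Hoelder's inequalities\<close>

text \<open>Convexity of the power function up to the endpoint 0, where it reduces to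
  \<open>u powr r \<le> u\<close> for u in [0,1].\<close>

lemma powr_convex_combination:
  assumes "1 \<le> r" "0 \<le> x" "0 \<le> y" "0 \<le> u" "0 \<le> v" "u + v = 1"
  shows "(u * x + v * y) powr r \<le> u * x powr r + v * y powr (r::real)"
proof -
  have *: "(u * x) powr r \<le> u * x powr r" if "0 \<le> x" "0 \<le> u" "u \<le> 1" for u x :: real
  proof -
    have "u powr r \<le> u powr 1" using that assms(1) by (intro powr_mono') auto
    then show ?thesis using that by (simp add: powr_mult mult_right_mono)
  qed
  consider "x = 0" | "y = 0" | "0 < x" "0 < y" using assms by force
  then show ?thesis
  proof cases
    case 1 then show ?thesis using *[of y v] assms by simp
  next
    case 2 then show ?thesis using *[of x u] assms by simp
  next
    case 3
    have u: "u = 1 - v" using assms by simp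
    show ?thesis
      unfolding u using convex_onD[OF powr_convex[OF assms(1)], of v x y] assms 3 by simp
  qed
qed

text \<open>Minkowski's inequality by normalisation: with A, B the two norms, (a+b)/(A+B) is the
  convex combination of a/A and b/B with weights A/(A+B) and B/(A+B). Convexity of the r-th power
  then bounds the sum of the r-th powers by 1.\<close>

lemma lseq_add:
  assumes "1 \<le> p" "lseq p a" "lseq p b"
  shows "lseq p (\<lambda>n. a n + b n)"
    "lseq_norm p (\<lambda>n. a n + b n) \<le> lseq_norm p a + lseq_norm p b"
proof -
  let ?A = "lseq_norm p a" and ?B = "lseq_norm p b"
  have nn: "0 \<le> ?A" "0 \<le> ?B" "\<And>n. 0 \<le> a n" "\<And>n. 0 \<le> b n"
    using assms lseq_norm_nonneg lseq_nonneg by auto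
  have "lseq p (\<lambda>n. a n + b n) \<and> lseq_norm p (\<lambda>n. a n + b n) \<le> ?A + ?B"
    using assms(1)
  proof (cases rule: ereal_ge_1_cases)
    case (1 r)
    consider "?A = 0" | "?B = 0" | "0 < ?A" "0 < ?B" using nn by force
    then show ?thesis
    proof cases
      case 1
      then have "a = (\<lambda>n. 0)" using lseq_le_norm[OF assms(1,2)] nn(3) by (intro ext antisym) auto
      then show ?thesis using assms 1 by simp
    next
      case 2
      then have "b = (\<lambda>n. 0)" using lseq_le_norm[OF assms(1,3)] nn(4) by (intro ext antisym) auto
      then show ?thesis using assms 2 by simp
    next
      case 3
      let ?u = "?A / (?A + ?B)" and ?v = "?B / (?A + ?B)"
      have uv: "?u + ?v = 1" "0 \<le> ?u" "0 \<le> ?v"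
        using 3 add_divide_distrib[of ?A ?B "?A + ?B"] by auto
      have "(\<Sum>n<N. (a n + b n) powr r) \<le> (?A + ?B) powr r" for N
      proof -
        have "(a n + b n) powr r \<le> (?A + ?B) powr r * (?u * (a n powr r / ?A powr r) + ?v * (b n powr r / ?B powr r))" for n
        proof -
          have "a n + b n = (?A + ?B) * (?u * (a n / ?A) + ?v * (b n / ?B))"
            using 3 by (simp add: distrib_left)
          then have "(a n + b n) powr r = (?A + ?B) powr r * (?u * (a n / ?A) + ?v * (b n / ?B)) powr r"
            using nn by (simp only: powr_mult[symmetric])
          also have "\<dots> \<le> (?A + ?B) powr r * (?u * (a n / ?A) powr r + ?v * (b n / ?B) powr r)"
            using uv nn \<open>1 \<le> r\<close> by (intro mult_left_mono powr_convex_combination) auto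
          finally show ?thesis using nn by (simp add: powr_divide)
        qed
        then have "(\<Sum>n<N. (a n + b n) powr r) \<le> (\<Sum>n<N. (?A + ?B) powr r * (?u * (a n powr r / ?A powr r) + ?v * (b n powr r / ?B powr r)))"
          by (rule sum_mono)
        also have "\<dots> = (?A + ?B) powr r * (?u * ((\<Sum>n<N. a n powr r) / ?A powr r) + ?v * ((\<Sum>n<N. b n powr r) / ?B powr r))"
          by (simp only: sum_distrib_left[symmetric] sum.distrib sum_divide_distrib[symmetric])
        also have "\<dots> \<le> (?A + ?B) powr r * (?u * 1 + ?v * 1)"
        proof -
          have "(\<Sum>n<N. a n powr r) / ?A powr r \<le> 1" "(\<Sum>n<N. b n powr r) / ?B powr r \<le> 1"
            using lseq_sum_le[of r _ "{..<N}"] assms \<open>p = ereal r\<close> \<open>1 \<le> r\<close> 3 by (auto simp: divide_le_eq_1)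
          then show ?thesis using uv by (intro mult_left_mono add_mono) auto
        qed
        also have "\<dots> = (?A + ?B) powr r" using uv by simp
        finally show ?thesis .
      qed
      then show ?thesis
        using lseq_realI[of r "\<lambda>n. a n + b n" "?A + ?B"] nn 1 by auto
    qed
  next
    case 2
    have "(\<lambda>n. a n + b n) \<longlonglongrightarrow> 0"
      using tendsto_add[of a 0 sequentially b 0] assms 2 by (simp add: lseq_PInf)
    moreover have "a n + b n \<le> ?A + ?B" for n
      using lseq_le_norm assms by (simp add: add_mono)
    ultimately show ?thesis using 2 nn lseq_PInf_norm_le by (auto simp: lseq_PInf)
  qed
  then show "lseq p (\<lambda>n. a n + b n)" "lseq_norm p (\<lambda>n. a n + b n) \<le> ?A + ?B" by auto
qed

text \<open>Fatou's lemma for sequence norms: a bound on every finite partial sum survives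
  coordinatewise limits. Such limits of null sequences need not be null, so for c_0 this is a
  separate hypothesis.\<close>

lemma lseq_limit:
  assumes "1 \<le> p" and C: "\<And>k. lseq p (b k)" "\<And>k. lseq_norm p (b k) \<le> C"
    and lim: "\<And>n. (\<lambda>k. b k n) \<longlonglongrightarrow> a n"
    and inf: "p = \<infinity> \<Longrightarrow> a \<longlonglongrightarrow> 0"
  shows "lseq p a" "lseq_norm p a \<le> C"
proof -
  have nn: "0 \<le> a n" for n
    using lim[of n] by (rule LIMSEQ_le_const) (use lseq_nonneg[OF C(1)] in blast)
  have C0: "0 \<le> C" using C(2)[of 0] lseq_norm_nonneg[OF C(1)[of 0]] by simp
  have "lseq p a \<and> lseq_norm p a \<le> C"
    using assms(1)
  proof (cases rule: ereal_ge_1_cases)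
    case (1 r)
    have "(\<Sum>n<N. a n powr r) \<le> C powr r" for N
    proof (rule LIMSEQ_le_const2)
      show "(\<lambda>k. \<Sum>n<N. b k n powr r) \<longlonglongrightarrow> (\<Sum>n<N. a n powr r)"
        using 1 nn lseq_nonneg[OF C(1)] by (intro tendsto_sum tendsto_powr' lim tendsto_const) simp_all
      have "(\<Sum>n<N. b k n powr r) \<le> C powr r" for k
      proof -
        have "(\<Sum>n<N. b k n powr r) \<le> lseq_norm p (b k) powr r"
          using lseq_sum_le 1 C by simp
        also have "\<dots> \<le> C powr r" using 1 C lseq_norm_nonneg by (intro powr_mono2) auto
        finally show ?thesis .
      qed
      then show "\<exists>N'. \<forall>k\<ge>N'. (\<Sum>n<N. b k n powr r) \<le> C powr r" by auto
    qed
    then show ?thesis using lseq_realI[of r a C] nn C0 1 by auto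
  next
    case 2
    have "a n \<le> C" for n
      using lim[of n] by (rule LIMSEQ_le_const2) (meson C lseq_le_norm[OF assms(1)] order_trans)
    then show ?thesis using 2 inf nn lseq_PInf_norm_le by (auto simp: lseq_PInf)
  qed
  then show "lseq p a" "lseq_norm p a \<le> C" by auto
qed

lemma lseq_1: "lseq 1 a \<longleftrightarrow> (\<forall>n. 0 \<le> a n) \<and> summable a"
proof -
  have "lseq 1 a \<longleftrightarrow> (\<forall>n. 0 \<le> a n) \<and> summable (\<lambda>n. a n powr 1)"
    using lseq_real[of 1 a] by (simp add: one_ereal_def)
  moreover have "(\<lambda>n. a n powr 1) = a" if "\<forall>n. 0 \<le> a n"
    using that by auto
  ultimately show ?thesis by (auto simp del: powr_one')
qed

lemma lseq_norm_1:
  assumes "lseq 1 a" shows "lseq_norm 1 a = (\<Sum>n. a n)"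
proof -
  have "(\<lambda>n. a n powr 1) = a" using assms by (auto simp: lseq_1)
  moreover have "0 \<le> (\<Sum>n. a n)" using assms by (auto simp: lseq_1 intro: suminf_nonneg)
  ultimately show ?thesis by (simp add: lseq_norm_def)
qed

lemma lseq_1I:
  assumes "\<And>n. 0 \<le> a n" "0 \<le> C" "\<And>N. (\<Sum>n<N. a n) \<le> C"
  shows "lseq 1 a" "lseq_norm 1 a \<le> C"
  using lseq_realI[of 1 a C] assms by (simp_all add: one_ereal_def)

lemma conj_exp_simps: "conj_exp 1 = \<infinity>" "conj_exp \<infinity> = 1"
  "1 < r \<Longrightarrow> conj_exp (ereal r) = ereal (r / (r - 1))"
  by (auto simp: conj_exp_def one_ereal_def field_simps)

text \<open>For exponents strictly between 1 and infinity, Young's inequality is applied to the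
  terms divided by their norms, and 1/r + 1/s = 1 sums the result to 1.\<close>

lemma lseq_Holder:
  assumes "1 \<le> p" "lseq p a" "lseq (conj_exp p) b"
  shows "lseq 1 (\<lambda>n. a n * b n)"
    "lseq_norm 1 (\<lambda>n. a n * b n) \<le> lseq_norm p a * lseq_norm (conj_exp p) b"
proof -
  let ?A = "lseq_norm p a" and ?B = "lseq_norm (conj_exp p) b"
  have nn: "0 \<le> ?A" "0 \<le> ?B" "\<And>n. 0 \<le> a n" "\<And>n. 0 \<le> b n"
    using assms lseq_norm_nonneg lseq_nonneg by auto
  have q: "1 \<le> conj_exp p" using conj_exp assms by auto
  \<comment> \<open>The endpoint pair (1, infinity); by symmetry of the product it serves both p = 1
    and p = infinity.\<close>
  have *: "lseq 1 (\<lambda>n. f n * g n) \<and> lseq_norm 1 (\<lambda>n. f n * g n) \<le> lseq_norm 1 f * lseq_norm \<infinity> g"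
    if "lseq 1 f" "lseq \<infinity> g" for f g
  proof -
    have f: "lseq 1 (\<lambda>n. lseq_norm \<infinity> g * f n)"
      "lseq_norm 1 (\<lambda>n. lseq_norm \<infinity> g * f n) = lseq_norm \<infinity> g * lseq_norm 1 f"
      using lseq_scale[of 1 f "lseq_norm \<infinity> g"] that lseq_norm_nonneg by auto
    have "0 \<le> f n * g n" "f n * g n \<le> lseq_norm \<infinity> g * f n" for n
      using that lseq_nonneg lseq_PInf_le_norm[of g n] by (auto simp: mult.commute[of _ "f n"] intro!: mult_left_mono)
    then show ?thesis using lseq_mono[of 1, OF _ f(1), of "\<lambda>n. f n * g n"] f(2) by (simp add: mult.commute)
  qed
  have "lseq 1 (\<lambda>n. a n * b n) \<and> lseq_norm 1 (\<lambda>n. a n * b n) \<le> ?A * ?B"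
    using assms(1)
  proof (cases rule: ereal_ge_1_cases)
    case (1 r)
    show ?thesis
    proof (cases "r = 1")
      case True
      then show ?thesis using *[of a b] assms 1 by (simp add: conj_exp_simps flip: one_ereal_def)
    next
      case False
      define s where "s = r / (r - 1)"
      have s: "1 < r" "1 < s" "1 / r + 1 / s = 1" "conj_exp p = ereal s"
        using False 1 by (auto simp: s_def conj_exp_simps field_simps)
      consider "?A = 0" | "?B = 0" | "0 < ?A" "0 < ?B" using nn by force
      then show ?thesis
      proof cases
        case 1
        then have "a = (\<lambda>n. 0)" using lseq_le_norm[OF assms(1,2)] nn(3) by (intro ext antisym) auto
        then show ?thesis using nn lseq_zero[of 1] by simp
      next
        case 2
        then have "b = (\<lambda>n. 0)" using lseq_le_norm[OF q assms(3)] nn(4) by (intro ext antisym) auto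
        then show ?thesis using nn lseq_zero[of 1] by simp
      next
        case 3
        have "(\<Sum>n<N. a n * b n) \<le> ?A * ?B" for N
        proof -
          have "a n * b n \<le> ?A * ?B * (a n powr r / ?A powr r / r + b n powr s / ?B powr s / s)" for n
          proof -
            have "a n * b n = ?A * ?B * ((a n / ?A) * (b n / ?B))" using 3 by simp
            also have "\<dots> \<le> ?A * ?B * ((a n / ?A) powr r / r + (b n / ?B) powr s / s)"
              using nn s by (intro mult_left_mono Youngs_inequality) auto
            finally show ?thesis using nn by (simp add: powr_divide)
          qed
          then have "(\<Sum>n<N. a n * b n) \<le> (\<Sum>n<N. ?A * ?B * (a n powr r / ?A powr r / r + b n powr s / ?B powr s / s))"
            by (rule sum_mono)
          also have "\<dots> = ?A * ?B * ((\<Sum>n<N. a n powr r) / ?A powr r / r + (\<Sum>n<N. b n powr s) / ?B powr s / s)"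
            by (simp only: sum_distrib_left[symmetric] sum.distrib sum_divide_distrib[symmetric])
          also have "\<dots> \<le> ?A * ?B * (1 / r + 1 / s)"
          proof -
            have "(\<Sum>n<N. a n powr r) / ?A powr r \<le> 1" "(\<Sum>n<N. b n powr s) / ?B powr s \<le> 1"
              using lseq_sum_le[of r a "{..<N}"] lseq_sum_le[of s b "{..<N}"] assms \<open>p = ereal r\<close> s 3
              by (auto simp: divide_le_eq_1)
            then show ?thesis using s nn by (intro mult_left_mono add_mono divide_right_mono) auto
          qed
          also have "\<dots> = ?A * ?B" using s by simp
          finally show ?thesis .
        qed
        then show ?thesis using lseq_1I[of "\<lambda>n. a n * b n" "?A * ?B"] nn by auto
      qed
    qed
  next
    case 2
    then show ?thesis using *[of b a] assms by (simp add: conj_exp_simps mult.commute)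
  qed
  then show "lseq 1 (\<lambda>n. a n * b n)" "lseq_norm 1 (\<lambda>n. a n * b n) \<le> ?A * ?B" by auto
qed

text \<open>
  For \<open>p < \<infinity>\<close> the weights are built from the tails \<open>t\<^sub>n\<close> of the series of \<open>b\<^sub>n = a\<^sub>n\<^sup>p\<close>: the series of
  \<open>b\<^sub>n\<close> divided by the square root of \<open>t\<^sub>n\<close> is dominated by a telescoping one. The summand
  \<open>(1/2)\<^sup>n\<close> keeps the tails positive.
\<close>

lemma lseq_factor_null:
  assumes "1 \<le> p" "lseq p a" "1 < c"
  obtains l where "\<And>n. 0 < l n" "\<And>n. l n \<le> 1" "l \<longlonglongrightarrow> 0"
    "lseq p (\<lambda>n. a n / l n)" "lseq_norm p (\<lambda>n. a n / l n) \<le> c * lseq_norm p a"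
proof -
  let ?A = "lseq_norm p a"
  have nn: "0 \<le> ?A" "\<And>n. 0 \<le> a n" using assms lseq_norm_nonneg lseq_nonneg by auto
  have inv: "(\<lambda>n. 1 / real (Suc n)) \<longlonglongrightarrow> 0"
    using LIMSEQ_inverse_real_of_nat by (simp add: inverse_eq_divide)
  show thesis
  proof (cases "?A = 0")
    case True
    then have "a n = 0" for n using lseq_le_norm[OF assms(1,2), of n] nn(2)[of n] by simp
    then show thesis using inv that[of "\<lambda>n. 1 / real (Suc n)"] True lseq_zero[of p] by simp
  next
    case False
    then have A: "0 < ?A" using nn by simp
    from assms(1) show thesis
    proof (cases rule: ereal_ge_1_cases)
      case (1 r)
      define b where "b n = a n powr r" for n
      define d where "d n = b n + (1/2)^n" for n :: nat
      define t where "t n = suminf d - sum d {..<n}" for n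
      have b: "summable b" "\<And>n. 0 \<le> b n" using assms 1 by (auto simp: b_def[abs_def] lseq_real)
      have d: "summable d" unfolding d_def using b by (intro summable_add) (auto simp: summable_geometric)
      have dpos: "0 < d n" for n using b(2)[of n] by (simp add: d_def add_nonneg_pos)
      have tpos: "0 < t n" for n using sum_less_suminf[OF d, of n] dpos by (simp add: t_def)
      have t0: "t \<longlonglongrightarrow> 0"
        unfolding t_def using tendsto_diff[OF tendsto_const summable_LIMSEQ[OF d], of "suminf d"] by simp
      have step: "b n / sqrt (t n) \<le> 2 * (sqrt (t n) - sqrt (t (Suc n)))" for n
      proof -
        have "b n \<le> t n - t (Suc n)" by (simp add: t_def d_def)
        also have "\<dots> = (sqrt (t n) - sqrt (t (Suc n))) * (sqrt (t n) + sqrt (t (Suc n)))"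
          using tpos[of n] tpos[of "Suc n"] by (simp add: algebra_simps)
        also have "\<dots> \<le> (sqrt (t n) - sqrt (t (Suc n))) * (2 * sqrt (t n))"
        proof -
          have "t (Suc n) \<le> t n" using dpos[of n] by (simp add: t_def)
          then show ?thesis by (intro mult_left_mono) auto
        qed
        finally show ?thesis using tpos[of n] by (simp add: pos_divide_le_eq mult_ac)
      qed
      have bsum: "(\<Sum>n<N. b n / sqrt (t n)) \<le> 2 * sqrt (t 0)" for N
      proof -
        have "(\<Sum>n<N. b n / sqrt (t n)) \<le> (\<Sum>n<N. 2 * (sqrt (t n) - sqrt (t (Suc n))))"
          by (intro sum_mono step)
        also have "\<dots> = 2 * (sqrt (t 0) - sqrt (t N))"
          by (simp only: sum_distrib_left[symmetric] sum_lessThan_telescope'[of "\<lambda>n. sqrt (t n)"])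
        also have "\<dots> \<le> 2 * (sqrt (t 0) - 0)"
          using tpos[of N] by (intro mult_left_mono diff_left_mono) auto
        finally show ?thesis by simp
      qed
      \<comment> \<open>Chosen so that \<open>e\<close> times the bound
        \<open>2 * sqrt (t 0)\<close> from \<open>bsum\<close> is exactly the slack between
        \<open>?A powr r\<close> and \<open>(c * ?A) powr r\<close>.\<close>
      define e where "e = (c powr r - 1) * ?A powr r / (2 * sqrt (t 0))"
      have c: "1 < c powr r" using assms(3) 1 by (simp add: gr_one_powr)
      have e: "0 < e" using c A tpos[of 0] by (simp add: e_def)
      define u where "u n = 1 + e / sqrt (t n)" for n
      have u: "1 < u n" for n using e tpos[of n] by (simp add: u_def)
      \<comment> \<open>The exponent gives \<open>(a n / l n) powr r = b n * u n\<close>. As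
        \<open>u\<close> exceeds 1 and tends to infinity with vanishing tails, \<open>l\<close> is a
        null sequence in (0,1].\<close>
      define l where "l n = u n powr (- 1 / r)" for n
      have quot: "(a n / l n) powr r = b n * u n" for n
      proof -
        have "l n powr r = inverse (u n)"
          unfolding l_def powr_powr using u[of n] 1 by (simp add: powr_minus)
        moreover have "0 \<le> l n" by (simp add: l_def)
        ultimately show ?thesis
          using nn(2)[of n] by (simp add: powr_divide b_def) (simp add: divide_inverse)
      qed
      have "(\<Sum>n<N. (a n / l n) powr r) \<le> (c * ?A) powr r" for N
      proof -
        have "(\<Sum>n<N. (a n / l n) powr r) = (\<Sum>n<N. b n) + e * (\<Sum>n<N. b n / sqrt (t n))"
          unfolding quot u_def by (simp add: algebra_simps sum.distrib sum_distrib_left)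
        also have "\<dots> \<le> ?A powr r + e * (2 * sqrt (t 0))"
          using e bsum lseq_sum_le[of r a "{..<N}"] assms 1 by (intro add_mono mult_left_mono) (auto simp: b_def)
        also have "\<dots> = c powr r * ?A powr r"
        proof -
          have "e * (2 * sqrt (t 0)) = (c powr r - 1) * ?A powr r"
            using tpos[of 0] by (simp add: e_def)
          then show ?thesis by (simp add: left_diff_distrib)
        qed
        finally show ?thesis using assms(3) nn(1) by (simp add: powr_mult)
      qed
      then have *: "lseq p (\<lambda>n. a n / l n)" "lseq_norm p (\<lambda>n. a n / l n) \<le> c * ?A"
        using lseq_realI[of r "\<lambda>n. a n / l n" "c * ?A"] nn assms 1 by (auto simp: l_def)
      have "filterlim (\<lambda>n. sqrt (t n)) (at_right 0) sequentially"
        using tendsto_real_sqrt[OF t0] tpos by (intro tendsto_imp_filterlim_at_right) (auto simp: eventually_sequentially)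
      then have "filterlim (\<lambda>n. inverse (sqrt (t n))) at_top sequentially"
        by (rule filterlim_compose[OF filterlim_inverse_at_top_right])
      then have "filterlim (\<lambda>n. e * inverse (sqrt (t n))) at_top sequentially"
        using e by (intro filterlim_tendsto_pos_mult_at_top[OF tendsto_const])
      then have "filterlim u at_top sequentially"
        unfolding u_def divide_inverse by (intro filterlim_tendsto_add_at_top[OF tendsto_const])
      then have "l \<longlonglongrightarrow> 0" unfolding l_def using 1 by (intro tendsto_neg_powr) auto
      moreover have "0 < l n" "l n \<le> 1" for n
      proof -
        show "0 < l n" using u[of n] by (simp add: l_def)
        have "u n powr (-1/r) \<le> u n powr 0" using u[of n] 1 by (intro powr_mono) auto
        then show "l n \<le> 1" using u[of n] by (simp add: l_def)
      qed
      ultimately show thesis using * that[of l] by auto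
    next
      case 2
      \<comment> \<open>The square root leaves \<open>a n / l n\<close> below
        \<open>sqrt (a n * ?A)\<close>, which is still null and at most \<open>?A\<close>. The
        second entry keeps the weights positive where \<open>a\<close> vanishes.\<close>
      define l where "l n = max (sqrt (a n / ?A)) (1 / real (Suc n))" for n
      have le: "a n \<le> ?A" for n using lseq_le_norm assms by auto
      have pos: "0 < l n" for n by (simp add: l_def less_max_iff_disj)
      have "sqrt (a n / ?A) \<le> 1" for n using le[of n] A by simp
      then have l1: "l n \<le> 1" for n by (simp add: l_def)
      have a0: "a \<longlonglongrightarrow> 0" using assms 2 by (simp add: lseq_PInf)
      have "(\<lambda>n. sqrt (a n / ?A)) \<longlonglongrightarrow> sqrt (0 / ?A)"
        using A by (intro tendsto_real_sqrt tendsto_divide a0 tendsto_const) auto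
      then have "l \<longlonglongrightarrow> max 0 0" unfolding l_def using inv by (intro tendsto_max) auto
      then have l0: "l \<longlonglongrightarrow> 0" by simp
      have key: "a n / l n \<le> sqrt (a n * ?A)" for n
      proof -
        have "a n = sqrt (a n * ?A) * sqrt (a n / ?A)"
          using A nn(2)[of n] by (simp flip: real_sqrt_mult)
        also have "\<dots> \<le> sqrt (a n * ?A) * l n"
          using A nn(2)[of n] by (intro mult_left_mono) (auto simp: l_def)
        finally show ?thesis using pos[of n] by (simp add: pos_divide_le_eq)
      qed
      have s0: "(\<lambda>n. sqrt (a n * ?A)) \<longlonglongrightarrow> sqrt (0 * ?A)"
        by (intro tendsto_real_sqrt tendsto_mult a0 tendsto_const)
      have "(\<lambda>n. a n / l n) \<longlonglongrightarrow> 0"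
        by (rule tendsto_sandwich[OF _ _ tendsto_const[of 0] s0[unfolded mult_zero_left real_sqrt_zero]])
           (use nn pos key in \<open>auto intro!: always_eventually divide_nonneg_pos\<close>)
      moreover have "a n / l n \<le> c * ?A" for n
      proof -
        have "sqrt (a n * ?A) \<le> sqrt (?A * ?A)"
          using A le[of n] by (intro real_sqrt_le_mono mult_right_mono) auto
        also have "\<dots> \<le> c * ?A" using A assms(3) by simp
        finally show ?thesis using key[of n] by simp
      qed
      ultimately show thesis
        using that[of l] pos l1 l0 nn 2 lseq_PInf_norm_le[of "\<lambda>n. a n / l n"]
        by (auto simp: lseq_PInf divide_nonneg_pos)
    qed
  qed
qed

section \<open>Normed spaces and bounded operators\<close>

lemma scalars_simps [simp]:
  "carrier scalars = UNIV" "\<zero>\<^bsub>scalars\<^esub> = 0" "\<one>\<^bsub>scalars\<^esub> = 1"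
  "a \<oplus>\<^bsub>scalars\<^esub> b = a + b" "a \<otimes>\<^bsub>scalars\<^esub> b = a * b" "a \<odot>\<^bsub>scalars\<^esub> b = a * b"
  "vnorm scalars a = norm a"
  by (simp_all add: scalars_def)

lemma scalars_uminus [simp]: "\<ominus>\<^bsub>scalars\<^esub> (a::'k::real_normed_field) = - a"
proof -
  interpret cring "scalars :: ('k, 'k) normed_module" by (rule cring_scalars)
  show ?thesis by (rule minus_equality) auto
qed

context normed_space
begin

lemma smult_minus_one: "x \<in> carrier E \<Longrightarrow> (-1) \<odot> x = \<ominus> x"
  using smult_l_minus[of 1 x] smult_one[of x] by simp

lemma minus_closed' [simp]: "x \<in> carrier E \<Longrightarrow> y \<in> carrier E \<Longrightarrow> x \<ominus> y \<in> carrier E"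
  by (simp add: M.minus_eq)

lemma vnorm_minus_commute: "x \<in> carrier E \<Longrightarrow> y \<in> carrier E \<Longrightarrow> vnorm E (x \<ominus> y) = vnorm E (y \<ominus> x)"
  using vnorm_uminus[of "x \<ominus> y"] by (simp add: M.minus_eq M.minus_add M.a_comm)

lemma vdist_eq: "x \<in> carrier E \<Longrightarrow> y \<in> carrier E \<Longrightarrow> vdist E x y = vnorm E (x \<ominus> y)"
  by (simp add: vdist_def)

lemma add_minus_cancel_right: "x \<in> carrier E \<Longrightarrow> y \<in> carrier E \<Longrightarrow> (x \<oplus> y) \<ominus> y = x"
  by (simp add: M.minus_eq M.a_assoc M.r_neg)

lemma minus_add_cancel_right: "x \<in> carrier E \<Longrightarrow> y \<in> carrier E \<Longrightarrow> (x \<ominus> y) \<oplus> y = x"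
  by (simp add: M.minus_eq M.a_assoc M.l_neg)

lemma minus_self [simp]: "x \<in> carrier E \<Longrightarrow> x \<ominus> x = \<zero>"
  using add_minus_cancel_right[of \<zero> x] by simp

lemma vnorm_minus_triangle:
  assumes "x \<in> carrier E" "y \<in> carrier E" "z \<in> carrier E"
  shows "vnorm E (x \<ominus> z) \<le> vnorm E (x \<ominus> y) + vnorm E (y \<ominus> z)"
  using triangle[of x y z] assms by (simp add: vdist_eq)

lemma minus_eq_add_minus:
  "\<lbrakk>x \<in> carrier E; y \<in> carrier E; u \<in> carrier E; v \<in> carrier E\<rbrakk>
    \<Longrightarrow> (x \<oplus> y) \<ominus> (u \<oplus> v) = (x \<ominus> u) \<oplus> (y \<ominus> v)"
  by (simp add: M.minus_eq M.minus_add M.a_ac)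

lemma vnorm_finsum_le:
  assumes "finite I" "\<And>i. i \<in> I \<Longrightarrow> x i \<in> carrier E"
  shows "vnorm E (finsum E x I) \<le> (\<Sum>i\<in>I. vnorm E (x i))"
  using assms
proof (induction I)
  case (insert i I)
  then have "vnorm E (finsum E x (insert i I)) = vnorm E (x i \<oplus> finsum E x I)"
    by (subst M.finsum_insert) auto
  also have "\<dots> \<le> vnorm E (x i) + vnorm E (finsum E x I)"
    using insert by (intro vnorm_triangle M.finsum_closed) auto
  finally show ?case using insert by auto
qed auto

lemma finsum_lessThan_Suc:
  assumes "\<And>n. x n \<in> carrier E"
  shows "finsum E x {..<Suc N} = x N \<oplus> finsum E x {..<N}"
  using assms by (subst lessThan_Suc, subst M.finsum_insert) auto

lemma finsum_seq_closed [simp]: "(\<And>n. x n \<in> carrier E) \<Longrightarrow> finsum E x I \<in> carrier E"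
  by (intro M.finsum_closed) auto

lemma vsums_iff:
  assumes "\<And>n. x n \<in> carrier E"
  shows "vsums E x s \<longleftrightarrow>
    s \<in> carrier E \<and> (\<lambda>N. vnorm E (finsum E x {..<N} \<ominus> s)) \<longlonglongrightarrow> 0"
proof -
  have "s \<in> carrier E \<Longrightarrow> vdist E (finsum E x {..<N}) s = vnorm E (finsum E x {..<N} \<ominus> s)" for N
    using assms by (simp add: vdist_eq)
  then show ?thesis
    using assms by (auto simp: vsums_def limitin_metric_dist_null)
qed

lemma vsums_unique: "vsums E x s \<Longrightarrow> vsums E x t \<Longrightarrow> s = t"
  unfolding vsums_def by (rule limitin_metric_unique) auto

lemma vsums_zero: "vsums E (\<lambda>n. \<zero>) \<zero>"
  by (subst vsums_iff) (auto simp: M.finsum_zero)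

lemma vsums_norm_le:
  assumes x: "\<And>n. x n \<in> carrier E" and s: "vsums E x s"
    and sm: "summable (\<lambda>n. vnorm E (x n))" 
  shows "vnorm E s \<le> (\<Sum>n. vnorm E (x n))"
proof (rule LIMSEQ_le_const)
  let ?S = "\<Sum>n. vnorm E (x n)"
  have s': "s \<in> carrier E" "(\<lambda>N. vnorm E (finsum E x {..<N} \<ominus> s)) \<longlonglongrightarrow> 0"
    using s vsums_iff[of x s] x by auto
  show "(\<lambda>N. vnorm E (finsum E x {..<N} \<ominus> s) + ?S) \<longlonglongrightarrow> ?S"
    using tendsto_add[OF s'(2) tendsto_const] by simp
  have "vnorm E s \<le> vnorm E (finsum E x {..<N} \<ominus> s) + ?S" for N
  proof -
    let ?t = "finsum E x {..<N}"
    have t: "?t \<in> carrier E" using x by simp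
    have "vnorm E s \<le> vnorm E (s \<ominus> ?t) + vnorm E ?t"
      using vnorm_triangle[of "s \<ominus> ?t" ?t] t s' by (simp add: minus_add_cancel_right)
    moreover have "vnorm E ?t \<le> (\<Sum>i<N. vnorm E (x i))" using x by (intro vnorm_finsum_le) auto
    moreover have "\<dots> \<le> ?S" using sm x by (intro sum_le_suminf) (auto intro: vnorm_nonneg)
    ultimately show ?thesis using vnorm_minus_commute[OF t s'(1)] by simp
  qed
  then show "\<exists>N. \<forall>n\<ge>N. vnorm E s \<le> vnorm E (finsum E x {..<n} \<ominus> s) + ?S" by blast
qed

end

lemma (in banach_space) abs_summable_vsums:
  assumes x: "\<And>n. x n \<in> carrier E" and sm: "summable (\<lambda>n. vnorm E (x n))"
  obtains s where "vsums E x s"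
proof -
  have diff: "vnorm E (finsum E x {..<N} \<ominus> finsum E x {..<M}) \<le> (\<Sum>i\<in>{M..<N}. vnorm E (x i))"
    if "M \<le> N" for M N
  proof -
    have "finsum E x {..<N} = finsum E x ({M..<N} \<union> {..<M})"
      using that by (intro arg_cong[where f="finsum E x"]) auto
    also have "\<dots> = finsum E x {M..<N} \<oplus> finsum E x {..<M}"
      using x by (intro M.finsum_Un_disjoint) auto
    finally show ?thesis using x by (simp add: add_minus_cancel_right vnorm_finsum_le)
  qed
  have "MCauchy (\<lambda>N. finsum E x {..<N})"
    unfolding MCauchy_def
  proof (intro conjI allI impI)
    show "range (\<lambda>N. finsum E x {..<N}) \<subseteq> carrier E" using x by auto
    fix e :: real assume "0 < e"
    then obtain K where K: "\<And>m n. m \<ge> K \<Longrightarrow> norm (\<Sum>i\<in>{m..<n}. vnorm E (x i)) < e"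
      using sm unfolding summable_Cauchy by blast
    have "vdist E (finsum E x {..<n}) (finsum E x {..<m}) < e" if "K \<le> n" "K \<le> m" for n m
    proof -
      have "vnorm E (finsum E x {..<n} \<ominus> finsum E x {..<m}) < e" if "K \<le> m" "m \<le> n" for n m
        using diff[OF that(2)] K[OF that(1), of n] by simp
      note * = this
      show ?thesis
        using *[of n m] *[of m n] that x vnorm_minus_commute[of "finsum E x {..<n}" "finsum E x {..<m}"]
        by (cases "m \<le> n") (simp_all add: vdist_eq)
    qed
    then show "\<exists>K. \<forall>n n'. K \<le> n \<longrightarrow> K \<le> n' \<longrightarrow> vdist E (finsum E x {..<n}) (finsum E x {..<n'}) < e"
      by blast
  qed
  then show thesis using complete that unfolding mcomplete_def vsums_def by blast
qed

text \<open>Along a rapidly converging subsequence of a Cauchy sequence the increments are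
  absolutely summable. Their sum gives a limit of the subsequence, hence of the whole sequence. This
  criterion suits quotients, where series lift to representatives.\<close>

lemma (in normed_space) banach_spaceI:
  assumes "\<And>x. (\<And>n. x n \<in> carrier E) \<Longrightarrow> summable (\<lambda>n. vnorm E (x n)) \<Longrightarrow> \<exists>s. vsums E x s"
  shows "banach_space E"
proof
  show "mcomplete" unfolding mcomplete_def
  proof (intro allI impI)
    fix \<sigma> assume C: "MCauchy \<sigma>"
    then have \<sigma>: "\<And>n. \<sigma> n \<in> carrier E" by (auto simp: MCauchy_def)
    have "\<exists>N. \<forall>m n. N \<le> m \<longrightarrow> N \<le> n \<longrightarrow> vdist E (\<sigma> m) (\<sigma> n) < (1/2)^k" for k :: nat
      using C unfolding MCauchy_def by (meson zero_less_power half_gt_zero zero_less_one)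
    then obtain N where N: "\<And>k m n. N k \<le> m \<Longrightarrow> N k \<le> n \<Longrightarrow> vdist E (\<sigma> m) (\<sigma> n) < (1/2)^k"
      by metis
    \<comment> \<open>Summing successors makes \<open>r\<close> strictly increasing and keeps it
      above \<open>N\<close>.\<close>
    define r where "r k = (\<Sum>i\<le>k. Suc (N i))" for k
    have r: "strict_mono r" by (rule strict_mono_Suc_iff[THEN iffD2]) (simp add: r_def)
    have rN: "N k \<le> r k" for k unfolding r_def
      using member_le_sum[of k "{..k}" "\<lambda>i. Suc (N i)"] by simp
    define x where "x k = \<sigma> (r (Suc k)) \<ominus> \<sigma> (r k)" for k
    have x: "x k \<in> carrier E" for k using \<sigma> by (simp add: x_def)
    have xle: "vnorm E (x k) \<le> (1/2)^k" for k
    proof -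
      have "r k \<le> r (Suc k)" using r by (simp add: strict_mono_Suc_iff less_imp_le)
      then have "vdist E (\<sigma> (r (Suc k))) (\<sigma> (r k)) < (1/2)^k"
        by (intro N) (use rN[of k] in auto)
      then show ?thesis using \<sigma> by (simp add: x_def vdist_eq)
    qed
    have "summable (\<lambda>n. vnorm E (x n))"
      by (rule summable_comparison_test'[where g="\<lambda>n. (1/2::real)^n" and N=0])
         (use xle x in \<open>auto simp: summable_geometric vnorm_nonneg\<close>)
    then obtain s where s: "vsums E x s" using assms[of x] x by auto
    then have s': "s \<in> carrier E" "(\<lambda>N. vnorm E (finsum E x {..<N} \<ominus> s)) \<longlonglongrightarrow> 0"
      using vsums_iff[of x] x by auto
    have part: "\<sigma> (r n) = finsum E x {..<n} \<oplus> \<sigma> (r 0)" for n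
    proof (induction n)
      case (Suc n)
      have "finsum E x {..<Suc n} \<oplus> \<sigma> (r 0) = x n \<oplus> (finsum E x {..<n} \<oplus> \<sigma> (r 0))"
        using x \<sigma> by (simp add: finsum_lessThan_Suc M.a_assoc)
      also have "\<dots> = \<sigma> (r (Suc n))"
        unfolding Suc[symmetric] x_def using \<sigma> by (simp add: minus_add_cancel_right)
      finally show ?case ..
    qed (use \<sigma> in simp)
    let ?a = "s \<oplus> \<sigma> (r 0)"
    have "vdist E (\<sigma> (r n)) ?a = vnorm E (finsum E x {..<n} \<ominus> s)" for n
    proof -
      have "\<sigma> (r n) \<ominus> ?a = (finsum E x {..<n} \<ominus> s) \<oplus> (\<sigma> (r 0) \<ominus> \<sigma> (r 0))"
        unfolding part[of n] by (rule minus_eq_add_minus) (use x \<sigma> s' in auto)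
      then show ?thesis using x \<sigma> s' by (simp add: vdist_eq)
    qed
    then have "limitin mtopology (\<sigma> \<circ> r) ?a sequentially"
      using s' \<sigma> by (simp add: limitin_metric_dist_null o_def)
    then show "\<exists>a. limitin mtopology \<sigma> a sequentially"
      using MCauchy_convergent_subsequence[OF C r] by auto
  qed
qed

section \<open>Bounded operators between normed spaces\<close>

locale bounded_op = E: normed_space E + F: normed_space F
  for E :: "('k::{real_normed_field,euclidean_space}, 'a) normed_module"
    and F :: "('k, 'b) normed_module" +
  fixes T assumes bounded: "bounded_operator E F T"
begin

lemma closed [simp]: "x \<in> carrier E \<Longrightarrow> T x \<in> carrier F"
  using bounded by (auto simp: bounded_operator_def)

lemma add: "x \<in> carrier E \<Longrightarrow> y \<in> carrier E \<Longrightarrow> T (x \<oplus>\<^bsub>E\<^esub> y) = T x \<oplus>\<^bsub>F\<^esub> T y"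
  using bounded by (auto simp: bounded_operator_def)

lemma smult: "x \<in> carrier E \<Longrightarrow> T (a \<odot>\<^bsub>E\<^esub> x) = a \<odot>\<^bsub>F\<^esub> T x"
  using bounded by (auto simp: bounded_operator_def)

lemma zero [simp]: "T \<zero>\<^bsub>E\<^esub> = \<zero>\<^bsub>F\<^esub>"
  using smult[of "\<zero>\<^bsub>E\<^esub>" 0] E.smult_l_null[of "\<zero>\<^bsub>E\<^esub>"] F.smult_l_null[of "T \<zero>\<^bsub>E\<^esub>"] by simp

lemma minus: "x \<in> carrier E \<Longrightarrow> y \<in> carrier E \<Longrightarrow> T (x \<ominus>\<^bsub>E\<^esub> y) = T x \<ominus>\<^bsub>F\<^esub> T y"
  using smult[of y "-1"]
  by (simp add: E.M.minus_eq F.M.minus_eq add E.smult_minus_one F.smult_minus_one)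

lemma finsum:
  assumes "finite I" "\<And>n. x n \<in> carrier E"
  shows "T (finsum E x I) = finsum F (\<lambda>n. T (x n)) I"
  using assms
proof (induction I)
  case (insert i I)
  then show ?case
    by (simp add: E.M.finsum_insert F.M.finsum_insert Pi_iff add)
qed simp

lemma op_norm_bdd: "bdd_above ((\<lambda>x. vnorm F (T x)) ` unit_ball E)"
proof -
  obtain C where C: "\<And>x. x \<in> carrier E \<Longrightarrow> vnorm F (T x) \<le> C * vnorm E x"
    using bounded unfolding bounded_operator_def by blast
  have "vnorm F (T x) \<le> \<bar>C\<bar>" if "x \<in> unit_ball E" for x
  proof -
    have x: "x \<in> carrier E" "vnorm E x \<le> 1" using that by (auto simp: unit_ball_def)
    \<comment> \<open>Boundedness does not fix the sign of \<open>C\<close>, hence the absolute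
      value.\<close>
    have "C * vnorm E x \<le> \<bar>C\<bar> * 1"
      using x E.vnorm_nonneg[OF x(1)] by (intro mult_mono) auto
    then show ?thesis using C[OF x(1)] by simp
  qed
  then show ?thesis by (rule bdd_aboveI2)
qed

lemma le_op_norm_unit: "x \<in> unit_ball E \<Longrightarrow> vnorm F (T x) \<le> op_norm E F T"
  unfolding op_norm_def by (rule cSUP_upper[OF _ op_norm_bdd])

lemma zero_unit_ball: "\<zero>\<^bsub>E\<^esub> \<in> unit_ball E"
  by (simp add: unit_ball_def)

lemma op_norm_nonneg: "0 \<le> op_norm E F T"
  using le_op_norm_unit[OF zero_unit_ball] by simp

lemma le_op_norm:
  assumes x: "x \<in> carrier E" shows "vnorm F (T x) \<le> op_norm E F T * vnorm E x"
proof (cases "vnorm E x = 0")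
  case True
  then show ?thesis using E.vnorm_eq_0[OF x] by simp
next
  case False
  then have pos: "0 < vnorm E x" using E.vnorm_nonneg[OF x] by simp
  let ?c = "of_real (inverse (vnorm E x)) :: 'k"
  have "?c \<odot>\<^bsub>E\<^esub> x \<in> unit_ball E"
    using x pos by (simp add: unit_ball_def E.vnorm_smult norm_inverse)
  from le_op_norm_unit[OF this] have "inverse (vnorm E x) * vnorm F (T x) \<le> op_norm E F T"
    using x pos by (simp add: smult F.vnorm_smult norm_inverse)
  then show ?thesis using pos by (simp add: field_simps)
qed

lemma op_norm_le:
  assumes "\<And>x. x \<in> carrier E \<Longrightarrow> vnorm F (T x) \<le> C * vnorm E x" "0 \<le> C"
  shows "op_norm E F T \<le> C"
  unfolding op_norm_def
proof (rule cSUP_least)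
  fix x assume "x \<in> unit_ball E"
  then have x: "x \<in> carrier E" "vnorm E x \<le> 1" by (auto simp: unit_ball_def)
  have "C * vnorm E x \<le> C" using x assms(2) mult_left_le by blast
  then show "vnorm F (T x) \<le> C" using assms(1)[OF x(1)] by simp
qed (use zero_unit_ball in auto)

lemma vsums:
  assumes x: "\<And>n. x n \<in> carrier E" and s: "vsums E x s"
  shows "vsums F (\<lambda>n. T (x n)) (T s)"
proof -
  have s': "s \<in> carrier E" "(\<lambda>N. vnorm E (finsum E x {..<N} \<ominus>\<^bsub>E\<^esub> s)) \<longlonglongrightarrow> 0"
    using s E.vsums_iff[of x s] x by auto
  have *: "finsum F (\<lambda>n. T (x n)) {..<N} \<ominus>\<^bsub>F\<^esub> T s = T (finsum E x {..<N} \<ominus>\<^bsub>E\<^esub> s)" for N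
    using x s' by (simp add: minus finsum)
  have "(\<lambda>N. vnorm F (T (finsum E x {..<N} \<ominus>\<^bsub>E\<^esub> s))) \<longlonglongrightarrow> 0"
  proof (rule tendsto_sandwich[OF _ _ tendsto_const[of 0]])
    show "(\<lambda>N. op_norm E F T * vnorm E (finsum E x {..<N} \<ominus>\<^bsub>E\<^esub> s)) \<longlonglongrightarrow> 0"
      using tendsto_mult_left[OF s'(2), of "op_norm E F T"] by simp
  qed (use x s' in \<open>auto intro!: always_eventually le_op_norm F.vnorm_nonneg\<close>)
  then show ?thesis using x s' by (subst F.vsums_iff) (auto simp: *)
qed

end

text \<open>Covers the degenerate case of the ideal property, in which \<open>R\<close> has norm 0
  and cannot be rescaled to norm 1.\<close>

lemma p_co_zero:
  fixes E :: "('k::{real_normed_field,euclidean_space}, 'a) normed_module"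
  assumes "normed_space E" "\<And>n. x n \<in> carrier E"
  shows "\<zero>\<^bsub>E\<^esub> \<in> p_co p E x"
proof -
  interpret normed_space E by fact
  have "(\<lambda>n. 0) \<in> lp q (scalars :: ('k, 'k) normed_module)"
    "lp_norm q (scalars :: ('k, 'k) normed_module) (\<lambda>n. 0) = 0" for q
    by (auto simp: lp_def lp_norm_def)
  moreover have "vsums E (\<lambda>n. 0 \<odot>\<^bsub>E\<^esub> x n) \<zero>\<^bsub>E\<^esub>"
    using vsums_zero assms(2) smult_l_null[of "x n" for n] by simp
  ultimately show ?thesis unfolding p_co_def
    by (auto intro!: bexI[of _ "\<lambda>n. 0"])
qed

text \<open>Additive inverses arise from scaling by -1, so sequence spaces and quotients do not have
  to construct them.\<close>

lemma normed_spaceI: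
  fixes E :: "('k::{real_normed_field,euclidean_space}, 'a) normed_module" (structure)
  assumes add_closed: "\<And>x y. x \<in> carrier E \<Longrightarrow> y \<in> carrier E \<Longrightarrow> x \<oplus> y \<in> carrier E"
    and zero_closed: "\<zero> \<in> carrier E"
    and smult_closed: "\<And>a x. x \<in> carrier E \<Longrightarrow> a \<odot> x \<in> carrier E"
    and assoc: "\<And>x y z. x \<in> carrier E \<Longrightarrow> y \<in> carrier E \<Longrightarrow> z \<in> carrier E \<Longrightarrow> (x \<oplus> y) \<oplus> z = x \<oplus> (y \<oplus> z)"
    and comm: "\<And>x y. x \<in> carrier E \<Longrightarrow> y \<in> carrier E \<Longrightarrow> x \<oplus> y = y \<oplus> x"
    and zero: "\<And>x. x \<in> carrier E \<Longrightarrow> \<zero> \<oplus> x = x"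
    and smult_zero: "\<And>x. x \<in> carrier E \<Longrightarrow> 0 \<odot> x = \<zero>"
    and smult_one: "\<And>x. x \<in> carrier E \<Longrightarrow> 1 \<odot> x = x"
    and smult_l_distr: "\<And>a b x. x \<in> carrier E \<Longrightarrow> (a + b) \<odot> x = a \<odot> x \<oplus> b \<odot> x"
    and smult_r_distr: "\<And>a x y. x \<in> carrier E \<Longrightarrow> y \<in> carrier E \<Longrightarrow> a \<odot> (x \<oplus> y) = a \<odot> x \<oplus> a \<odot> y"
    and smult_assoc: "\<And>a b x. x \<in> carrier E \<Longrightarrow> (a * b) \<odot> x = a \<odot> (b \<odot> x)"
    and norm_zero: "\<And>x. x \<in> carrier E \<Longrightarrow> vnorm E x = 0 \<Longrightarrow> x = \<zero>"
    and norm_triangle: "\<And>x y. x \<in> carrier E \<Longrightarrow> y \<in> carrier E \<Longrightarrow> vnorm E (x \<oplus> y) \<le> vnorm E x + vnorm E y"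
    and norm_smult: "\<And>a x. x \<in> carrier E \<Longrightarrow> vnorm E (a \<odot> x) = norm a * vnorm E x"
  shows "normed_space E"
proof -
  have inv: "\<exists>y\<in>carrier E. y \<oplus> x = \<zero>" if "x \<in> carrier E" for x
  proof (rule bexI)
    show "(-1) \<odot> x \<oplus> x = \<zero>"
      using smult_l_distr[OF that, of "-1" 1] smult_zero[OF that] smult_one[OF that] by simp
  qed (use smult_closed that in auto)
  have ag: "abelian_group E"
    by (rule abelian_groupI; fact add_closed zero_closed assoc comm zero inv)
  have "module scalars E"
    by (intro moduleI cring_scalars ag; simp)
      (fact smult_closed smult_l_distr smult_r_distr smult_assoc smult_one)+
  moreover have "vnorm E \<zero> = 0"
    using norm_smult[OF zero_closed, of 0] smult_zero[OF zero_closed] by simp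
  ultimately show ?thesis
    by (intro normed_space.intro normed_space_axioms.intro)
      (use norm_zero norm_triangle norm_smult in auto)
qed

lemma (in normed_space) lp_iff:
  "x \<in> lp p E \<longleftrightarrow> (\<forall>n. x n \<in> carrier E) \<and> lseq p (\<lambda>n. vnorm E (x n))"
  by (auto simp: lp_def lseq_def vnorm_nonneg)

lemma lp_norm_eq: "lp_norm p E x = lseq_norm p (\<lambda>n. vnorm E (x n))"
  by (simp add: lp_norm_def lseq_norm_def)

lemma lp_scalars_iff:
  "a \<in> lp p (scalars :: ('k::real_normed_field, 'k) normed_module) \<longleftrightarrow> lseq p (\<lambda>n. norm (a n))"
  by (auto simp: lp_def lseq_def)

section \<open>Sequence spaces\<close>

text \<open>By the convention in \<open>lp\<close> this is c_0 for \<open>q = \<infinity>\<close>,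
  so \<open>seqsp (conj_exp p)\<close> is precisely the space of coefficients in
  \<open>p_co\<close>, including p = 1.\<close>

definition seqsp :: "ereal \<Rightarrow> ('k::real_normed_field, nat \<Rightarrow> 'k) normed_module" where
  "seqsp q = \<lparr>carrier = lp q scalars, mult = \<lambda>a b n. a n * b n, one = \<lambda>n. 1, zero = \<lambda>n. 0,
     add = \<lambda>a b n. a n + b n, smult = \<lambda>c a n. c * a n, vnorm = lp_norm q scalars\<rparr>"

lemma seqsp_simps:
  "a \<in> carrier (seqsp q) \<longleftrightarrow> lseq q (\<lambda>n. norm (a n))"
  "\<zero>\<^bsub>seqsp q\<^esub> = (\<lambda>n. 0)"
  "a \<oplus>\<^bsub>seqsp q\<^esub> b = (\<lambda>n. a n + b n)"
  "c \<odot>\<^bsub>seqsp q\<^esub> a = (\<lambda>n. c * a n)"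
  "vnorm (seqsp q) a = lseq_norm q (\<lambda>n. norm (a n))"
  by (simp_all add: seqsp_def lp_scalars_iff lp_norm_eq)

lemma normed_space_seqsp:
  assumes "1 \<le> q"
  shows "normed_space (seqsp q :: ('k::{real_normed_field,euclidean_space}, nat \<Rightarrow> 'k) normed_module)"
proof -
  have add: "lseq q (\<lambda>n. norm (a n + b n))"
    "lseq_norm q (\<lambda>n. norm (a n + b n)) \<le> lseq_norm q (\<lambda>n. norm (a n)) + lseq_norm q (\<lambda>n. norm (b n))"
    if ab: "lseq q (\<lambda>n. norm (a n))" "lseq q (\<lambda>n. norm (b n))" for a b :: "nat \<Rightarrow> 'k"
    using lseq_mono[OF assms lseq_add(1)[OF assms ab], of "\<lambda>n. norm (a n + b n)"]
      lseq_add(2)[OF assms ab] by (auto simp: norm_triangle_ineq)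
  have zero: "a = (\<lambda>n. 0)" if "lseq q (\<lambda>n. norm (a n))" "lseq_norm q (\<lambda>n. norm (a n)) = 0" for a :: "nat \<Rightarrow> 'k"
    using lseq_le_norm[OF assms that(1)] that(2) by auto
  show ?thesis
    by (rule normed_spaceI)
      (auto simp: seqsp_simps algebra_simps norm_mult lseq_scale[OF assms] lseq_zero add zero)
qed

lemma seqsp_minus:
  assumes "1 \<le> q" "a \<in> carrier (seqsp q)" "b \<in> carrier (seqsp q)"
  shows "a \<ominus>\<^bsub>seqsp q\<^esub> b = (\<lambda>n. a n - (b n :: 'k::{real_normed_field,euclidean_space}))"
proof -
  interpret normed_space "seqsp q :: ('k, nat \<Rightarrow> 'k) normed_module"
    using assms(1) by (rule normed_space_seqsp)
  show ?thesis
    unfolding M.minus_eq smult_minus_one[OF assms(3), symmetric] by (simp add: seqsp_simps)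
qed

lemma seqsp_finsum:
  assumes "1 \<le> q" "\<And>k. x k \<in> carrier (seqsp q)"
  shows "finsum (seqsp q) x {..<N} = (\<lambda>n. \<Sum>k<(N::nat). x k n :: 'k::{real_normed_field,euclidean_space})"
proof -
  interpret normed_space "seqsp q :: ('k, nat \<Rightarrow> 'k) normed_module"
    using assms(1) by (rule normed_space_seqsp)
  show ?thesis
  proof (induct N)
    case (Suc N)
    then show ?case
      unfolding finsum_lessThan_Suc[OF assms(2)] by (simp add: seqsp_simps(3) add.commute)
  qed (simp add: seqsp_simps)
qed

lemma banach_space_seqsp:
  assumes q: "1 \<le> q"
  shows "banach_space (seqsp q :: ('k::{real_normed_field,euclidean_space}, nat \<Rightarrow> 'k) normed_module)"
    (is "banach_space ?E")
proof -
  interpret normed_space ?E using q by (rule normed_space_seqsp)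
  show ?thesis
  proof
    show "mcomplete" unfolding mcomplete_def
    proof (intro allI impI)
      fix f assume C: "MCauchy f"
      then have f: "\<And>k. f k \<in> carrier ?E" by (auto simp: MCauchy_def)
      have dist: "vdist ?E (f m) (f n) = lseq_norm q (\<lambda>i. norm (f m i - f n i))" for m n
        using f by (simp add: vdist_eq seqsp_minus[OF q] seqsp_simps)
      have dl: "lseq q (\<lambda>i. norm (f m i - f n i))" for m n
        using minus_closed'[OF f[of m] f[of n]] f by (simp add: seqsp_minus[OF q] seqsp_simps)
      have cau: "\<exists>K. \<forall>m\<ge>K. \<forall>n\<ge>K. lseq_norm q (\<lambda>i. norm (f m i - f n i)) < e" if "0 < e" for e
        using C that unfolding MCauchy_def dist by meson
      have "\<exists>l. (\<lambda>k. f k i) \<longlonglongrightarrow> l" for i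
      proof -
        have "Cauchy (\<lambda>k. f k i)"
          unfolding Cauchy_def dist_norm
        proof (intro allI impI)
          fix e :: real assume "0 < e"
          then obtain K where "\<And>m n. m \<ge> K \<Longrightarrow> n \<ge> K \<Longrightarrow> lseq_norm q (\<lambda>i. norm (f m i - f n i)) < e"
            using cau by meson
          then show "\<exists>M. \<forall>m\<ge>M. \<forall>n\<ge>M. norm (f m i - f n i) < e"
            using le_less_trans[OF lseq_le_norm[OF q dl]] by blast
        qed
        then show ?thesis by (simp add: Cauchy_convergent_iff convergent_def)
      qed
      then obtain a where a: "\<And>i. (\<lambda>k. f k i) \<longlonglongrightarrow> a i" by metis
      have lim: "lseq q (\<lambda>i. norm (f k i - a i)) \<and> lseq_norm q (\<lambda>i. norm (f k i - a i)) \<le> e"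
        if K: "\<And>m n. m \<ge> K \<Longrightarrow> n \<ge> K \<Longrightarrow> lseq_norm q (\<lambda>i. norm (f m i - f n i)) < e" and k: "K \<le> k" for K e k
      proof -
        \<comment> \<open>The shift by \<open>K\<close> makes the Cauchy bound valid for every
          index, as \<open>lseq_limit\<close> demands.\<close>
        have lm: "(\<lambda>n. norm (f k i - f (n + K) i)) \<longlonglongrightarrow> norm (f k i - a i)" for i
          by (intro tendsto_norm tendsto_diff tendsto_const LIMSEQ_ignore_initial_segment a)
        \<comment> \<open>For c_0 the limit is null because \<open>f K'\<close> is close to
          \<open>a\<close> uniformly in the coordinate, while \<open>f k - f K'\<close> is itself
          null.\<close>
        have inf: "(\<lambda>i. norm (f k i - a i)) \<longlonglongrightarrow> 0" if "q = \<infinity>"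
        proof (rule LIMSEQ_I)
          fix r :: real assume "0 < r"
          then obtain K' where K': "\<And>m n. m \<ge> K' \<Longrightarrow> n \<ge> K' \<Longrightarrow> lseq_norm q (\<lambda>i. norm (f m i - f n i)) < r/3"
            using cau[of "r/3"] by auto
          have *: "norm (f K' i - a i) \<le> r/3" for i
          proof (rule LIMSEQ_le_const2)
            show "(\<lambda>n. norm (f K' i - f n i)) \<longlonglongrightarrow> norm (f K' i - a i)"
              by (intro tendsto_norm tendsto_diff tendsto_const a)
            have "norm (f K' i - f n i) \<le> r/3" if "n \<ge> K'" for n
              using K'[of K' n] lseq_le_norm[OF q dl[of K' n], of i] that by simp
            then show "\<exists>N. \<forall>n\<ge>N. norm (f K' i - f n i) \<le> r/3" by blast
          qed
          have "(\<lambda>i. norm (f k i - f K' i)) \<longlonglongrightarrow> 0" using dl that by (simp add: lseq_PInf)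
          then obtain N where N: "\<And>i. i \<ge> N \<Longrightarrow> norm (f k i - f K' i) < r/3"
            using \<open>0 < r\<close> LIMSEQ_D[of _ 0 "r/3"] by fastforce
          have "norm (f k i - a i) < r" if "i \<ge> N" for i
          proof -
            have "norm (f k i - a i) \<le> norm (f k i - f K' i) + norm (f K' i - a i)"
              using norm_triangle_ineq[of "f k i - f K' i" "f K' i - a i"] by simp
            then show ?thesis using N[OF that] *[of i] \<open>0 < r\<close> by linarith
          qed
          then show "\<exists>N. \<forall>i\<ge>N. norm (norm (f k i - a i) - 0) < r" by auto
        qed
        show ?thesis
          using lseq_limit[OF q dl _ lm inf, of e] K[OF k] by (simp add: less_imp_le)
      qed
      obtain K0 where "\<And>m n. m \<ge> K0 \<Longrightarrow> n \<ge> K0 \<Longrightarrow> lseq_norm q (\<lambda>i. norm (f m i - f n i)) < 1"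
        using cau[of 1] by auto
      from lim[OF this order_refl]
      have "(\<lambda>i. f K0 i - a i) \<in> carrier ?E" by (simp add: seqsp_simps)
      \<comment> \<open>The limit is the difference of the two members \<open>f K0\<close> and
        \<open>f K0 - a\<close>.\<close>
      from minus_closed'[OF f[of K0] this] have acl: "a \<in> carrier ?E"
        by (simp add: seqsp_minus[OF q f \<open>(\<lambda>i. f K0 i - a i) \<in> carrier ?E\<close>] seqsp_simps)
      have "limitin mtopology f a sequentially"
        unfolding limit_metric_sequentially
      proof (intro conjI allI impI acl)
        fix e :: real assume "0 < e"
        then obtain K where K: "\<And>m n. m \<ge> K \<Longrightarrow> n \<ge> K \<Longrightarrow> lseq_norm q (\<lambda>i. norm (f m i - f n i)) < e/2"
          using cau[of "e/2"] by auto
        have "vdist ?E (f k) a < e" if "k \<ge> K" for k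
          using lim[OF K that] \<open>0 < e\<close> f acl by (simp add: vdist_eq seqsp_minus[OF q] seqsp_simps)
        then show "\<exists>N. \<forall>n\<ge>N. f n \<in> carrier ?E \<and> vdist ?E (f n) a < e" using f by blast
      qed
      then show "\<exists>a. limitin mtopology f a sequentially" by (rule exI[of _ a])
    qed
  qed
qed

text \<open>A scalar is determined by the members of a countable basis that contain it, hence by a
  set of naturals; pairing turns a sequence of such sets into one set of naturals. This lets
  quotients of sequence spaces be realised on every type of at least continuum size.\<close>

lemma lepoll_sequences:
  "(UNIV :: (nat \<Rightarrow> 'k::euclidean_space) set) \<lesssim> (UNIV :: real set)"
proof -
  obtain B :: "'k set set" where B: "countable B" "topological_basis B"
    using ex_countable_basis by auto
  have "B \<noteq> {}" using topological_basis_open[OF B(2)] B(2) by (metis UNIV_I empty_iff open_UNIV topological_basisE)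
  define f where "f x = {m. x \<in> from_nat_into B m}" for x
  have f: "x = y" if "f x = f y" for x y
  proof (rule ccontr)
    assume "x \<noteq> y"
    then obtain U where U: "open U" "x \<in> U" "y \<notin> U" using t1_space by blast
    then obtain V where V: "V \<in> B" "x \<in> V" "V \<subseteq> U" using B(2) topological_basisE by metis
    then obtain m where "V = from_nat_into B m" using from_nat_into_surj[OF B(1)] by metis
    then show False using that V U unfolding f_def by blast
  qed
  define g where "g a = {k. snd (prod_decode k) \<in> f (a (fst (prod_decode k)))}" for a :: "nat \<Rightarrow> 'k"
  have "inj g"
  proof (rule injI)
    fix a b assume "g a = g b"
    then have "prod_encode (n, m) \<in> g a \<longleftrightarrow> prod_encode (n, m) \<in> g b" for n m by simp
    then have "m \<in> f (a n) \<longleftrightarrow> m \<in> f (b n)" for n m by (simp add: g_def)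
    then show "a = b" using f by blast
  qed
  then have "(UNIV :: (nat \<Rightarrow> 'k) set) \<lesssim> (UNIV :: nat set set)" unfolding lepoll_def by blast
  then show ?thesis using nat_sets_eqpoll_reals lepoll_trans2 by blast
qed

section \<open>Quotients\<close>

text \<open>
  Quotients are realised on an arbitrary type: the classes are represented by the values of a
  function \<open>Q\<close> that is constant exactly on them, and the norm is the infimum over the fibres of \<open>Q\<close>.
\<close>

definition image_space ::
  "('k, 'a) normed_module \<Rightarrow> ('a \<Rightarrow> 'x) \<Rightarrow> ('k, 'x) normed_module" where
  "image_space G Q = \<lparr>carrier = Q ` carrier G, mult = \<lambda>x y. Q \<zero>\<^bsub>G\<^esub>, one = Q \<zero>\<^bsub>G\<^esub>, zero = Q \<zero>\<^bsub>G\<^esub>,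
     add = \<lambda>x y. Q (inv_into (carrier G) Q x \<oplus>\<^bsub>G\<^esub> inv_into (carrier G) Q y),
     smult = \<lambda>c x. Q (c \<odot>\<^bsub>G\<^esub> inv_into (carrier G) Q x),
     vnorm = \<lambda>x. Inf (vnorm G ` {a \<in> carrier G. Q a = x})\<rparr>"

text \<open>By \<open>Q_eq_iff\<close> the fibres of \<open>Q\<close> are the cosets of the kernel
  of \<theta>. The kernel is closed because \<theta> is bounded, which makes the infimum over a
  fibre a norm and not merely a seminorm.\<close>

locale quotient_op = bounded_op G F \<theta>
  for G :: "('k::{real_normed_field,euclidean_space}, 'a) normed_module"
    and F :: "('k, 'b) normed_module" and \<theta> +
  fixes Q :: "'a \<Rightarrow> 'x"
  assumes banach: "banach_space G"
    and Q_eq_iff: "a \<in> carrier G \<Longrightarrow> b \<in> carrier G \<Longrightarrow> Q a = Q b \<longleftrightarrow> \<theta> a = \<theta> b"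
begin

abbreviation "X \<equiv> image_space G Q"

lemma carrier_X: "carrier X = Q ` carrier G"
  by (simp add: image_space_def)

lemma Q_closed [simp]: "a \<in> carrier G \<Longrightarrow> Q a \<in> carrier X"
  by (simp add: carrier_X)

lemma repr: "a \<in> carrier G \<Longrightarrow> inv_into (carrier G) Q (Q a) \<in> carrier G"
  "a \<in> carrier G \<Longrightarrow> \<theta> (inv_into (carrier G) Q (Q a)) = \<theta> a"
proof -
  assume a: "a \<in> carrier G"
  then have *: "inv_into (carrier G) Q (Q a) \<in> carrier G" "Q (inv_into (carrier G) Q (Q a)) = Q a"
    by (auto intro: inv_into_into f_inv_into_f)
  then show "inv_into (carrier G) Q (Q a) \<in> carrier G"
    "\<theta> (inv_into (carrier G) Q (Q a)) = \<theta> a" using Q_eq_iff a by auto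
qed

lemma Q_zero: "\<zero>\<^bsub>X\<^esub> = Q \<zero>\<^bsub>G\<^esub>"
  by (simp add: image_space_def)

lemma Q_add: "a \<in> carrier G \<Longrightarrow> b \<in> carrier G \<Longrightarrow> Q a \<oplus>\<^bsub>X\<^esub> Q b = Q (a \<oplus>\<^bsub>G\<^esub> b)"
  by (simp add: image_space_def Q_eq_iff add repr)

lemma Q_smult: "a \<in> carrier G \<Longrightarrow> c \<odot>\<^bsub>X\<^esub> Q a = Q (c \<odot>\<^bsub>G\<^esub> a)"
  by (simp add: image_space_def Q_eq_iff smult repr)

lemma vnorm_X: "vnorm X x = Inf (vnorm G ` {a \<in> carrier G. Q a = x})"
  by (simp add: image_space_def)

lemma bdd_below_fibre: "bdd_below (vnorm G ` {a \<in> carrier G. Q a = x})"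
  by (auto intro!: bdd_belowI2[where m=0] E.vnorm_nonneg)

lemma vnorm_Q_le: "a \<in> carrier G \<Longrightarrow> vnorm X (Q a) \<le> vnorm G a"
  unfolding vnorm_X by (rule cInf_lower[OF _ bdd_below_fibre]) auto

lemma obtain_repr:
  assumes "x \<in> carrier X" "0 < e"
  obtains a where "a \<in> carrier G" "Q a = x" "vnorm G a < vnorm X x + e"
proof -
  have "vnorm G ` {a \<in> carrier G. Q a = x} \<noteq> {}" using assms(1) by (auto simp: carrier_X)
  then have "\<exists>t\<in>vnorm G ` {a \<in> carrier G. Q a = x}. t < vnorm X x + e"
    using assms(2) unfolding vnorm_X by (intro cInf_lessD) simp_all
  then show thesis using that by auto
qed

lemma vnorm_X_ge:
  assumes "x \<in> carrier X" "\<And>a. a \<in> carrier G \<Longrightarrow> Q a = x \<Longrightarrow> m \<le> vnorm G a"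
  shows "m \<le> vnorm X x"
proof (rule field_le_epsilon)
  fix e :: real assume "0 < e"
  with assms(1) obtain a where "a \<in> carrier G" "Q a = x" "vnorm G a < vnorm X x + e"
    by (rule obtain_repr)
  then show "m \<le> vnorm X x + e" using assms(2)[of a] by simp
qed

lemma normed_space_X: "normed_space X"
proof (rule normed_spaceI; (unfold carrier_X)?)
  show "x \<oplus>\<^bsub>X\<^esub> y \<in> Q ` carrier G" if "x \<in> Q ` carrier G" "y \<in> Q ` carrier G" for x y
    using that by (auto simp: Q_add)
  show "\<zero>\<^bsub>X\<^esub> \<in> Q ` carrier G" by (auto simp: Q_zero)
  show "a \<odot>\<^bsub>X\<^esub> x \<in> Q ` carrier G" if "x \<in> Q ` carrier G" for a x
    using that by (auto simp: Q_smult)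
  show "(x \<oplus>\<^bsub>X\<^esub> y) \<oplus>\<^bsub>X\<^esub> z = x \<oplus>\<^bsub>X\<^esub> (y \<oplus>\<^bsub>X\<^esub> z)"
    if "x \<in> Q ` carrier G" "y \<in> Q ` carrier G" "z \<in> Q ` carrier G" for x y z
    using that by (auto simp: Q_add E.M.a_assoc)
  show "x \<oplus>\<^bsub>X\<^esub> y = y \<oplus>\<^bsub>X\<^esub> x" if "x \<in> Q ` carrier G" "y \<in> Q ` carrier G" for x y
    using that by (auto simp: Q_add E.M.a_comm)
  show "\<zero>\<^bsub>X\<^esub> \<oplus>\<^bsub>X\<^esub> x = x" if "x \<in> Q ` carrier G" for x
    using that by (auto simp: Q_add Q_zero)
  show "0 \<odot>\<^bsub>X\<^esub> x = \<zero>\<^bsub>X\<^esub>" if "x \<in> Q ` carrier G" for x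
    using that E.smult_l_null by (auto simp: Q_smult Q_zero)
  show "1 \<odot>\<^bsub>X\<^esub> x = x" if "x \<in> Q ` carrier G" for x
    using that E.smult_one by (auto simp: Q_smult)
  show "(a + b) \<odot>\<^bsub>X\<^esub> x = a \<odot>\<^bsub>X\<^esub> x \<oplus>\<^bsub>X\<^esub> b \<odot>\<^bsub>X\<^esub> x" if "x \<in> Q ` carrier G" for a b x
    using that E.smult_l_distr[of a b] by (auto simp: Q_smult Q_add)
  show "a \<odot>\<^bsub>X\<^esub> (x \<oplus>\<^bsub>X\<^esub> y) = a \<odot>\<^bsub>X\<^esub> x \<oplus>\<^bsub>X\<^esub> a \<odot>\<^bsub>X\<^esub> y"
    if "x \<in> Q ` carrier G" "y \<in> Q ` carrier G" for a x y
    using that E.smult_r_distr[of a] by (auto simp: Q_smult Q_add)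
  show "(a * b) \<odot>\<^bsub>X\<^esub> x = a \<odot>\<^bsub>X\<^esub> (b \<odot>\<^bsub>X\<^esub> x)" if "x \<in> Q ` carrier G" for a b x
    using that E.smult_assoc1[of a b] by (auto simp: Q_smult)
  show "x = \<zero>\<^bsub>X\<^esub>" if x: "x \<in> Q ` carrier G" and n: "vnorm X x = 0" for x
  proof -
    obtain a where a: "a \<in> carrier G" "x = Q a" using x by auto
    \<comment> \<open>\<theta> is constant on the fibre, and the fibre contains elements of
      arbitrarily small norm. The summand 1 in \<open>M\<close> keeps the divisor positive when
      \<theta> vanishes.\<close>
    have "vnorm F (\<theta> a) \<le> 0"
    proof (rule field_le_epsilon)
      fix e :: real assume "0 < e"
      define M where "M = op_norm G F \<theta> + 1"
      have M: "0 < M" using op_norm_nonneg by (simp add: M_def)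
      obtain b where b: "b \<in> carrier G" "Q b = x" "vnorm G b < vnorm X x + e / M"
        using obtain_repr[of x "e / M"] x M \<open>0 < e\<close> carrier_X by auto
      have "vnorm F (\<theta> a) = vnorm F (\<theta> b)" using Q_eq_iff a b by metis
      also have "\<dots> \<le> op_norm G F \<theta> * vnorm G b" using le_op_norm[OF b(1)] .
      also have "\<dots> \<le> M * (e / M)" 
        using b n op_norm_nonneg \<open>0 < e\<close> M E.vnorm_nonneg[OF b(1)]
        by (intro mult_mono) (auto simp: M_def)
      finally show "vnorm F (\<theta> a) \<le> 0 + e" using M by simp
    qed
    then have "\<theta> a = \<zero>\<^bsub>F\<^esub>" using F.vnorm_nonneg F.vnorm_eq_0 a by (metis closed order_antisym)
    then show ?thesis using a Q_eq_iff[of a "\<zero>\<^bsub>G\<^esub>"] by (simp add: Q_zero)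
  qed
  show "vnorm X (x \<oplus>\<^bsub>X\<^esub> y) \<le> vnorm X x + vnorm X y"
    if xy: "x \<in> Q ` carrier G" "y \<in> Q ` carrier G" for x y
  proof (rule field_le_epsilon)
    fix e :: real assume e: "0 < e"
    obtain a where a: "a \<in> carrier G" "Q a = x" "vnorm G a < vnorm X x + e/2"
      using obtain_repr[of x "e/2"] xy e carrier_X by auto
    obtain b where b: "b \<in> carrier G" "Q b = y" "vnorm G b < vnorm X y + e/2"
      using obtain_repr[of y "e/2"] xy e carrier_X by auto
    have "vnorm X (x \<oplus>\<^bsub>X\<^esub> y) \<le> vnorm G (a \<oplus>\<^bsub>G\<^esub> b)"
      using a b Q_add[OF a(1) b(1)] vnorm_Q_le[of "a \<oplus>\<^bsub>G\<^esub> b"] by simp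
    also have "\<dots> \<le> vnorm G a + vnorm G b" using a b by (intro E.vnorm_triangle)
    finally show "vnorm X (x \<oplus>\<^bsub>X\<^esub> y) \<le> vnorm X x + vnorm X y + e" using a(3) b(3) by simp
  qed
  have smult_le: "vnorm X (c \<odot>\<^bsub>X\<^esub> x) \<le> norm c * vnorm X x" if x: "x \<in> Q ` carrier G" for c x
  proof (rule field_le_epsilon)
    fix e :: real assume e: "0 < e"
    obtain a where a: "a \<in> carrier G" "Q a = x" "vnorm G a < vnorm X x + e / (norm c + 1)"
      using obtain_repr[of x "e / (norm c + 1)"] x e carrier_X
      by (metis add_nonneg_pos divide_pos_pos norm_ge_zero zero_less_one)
    have "vnorm X (c \<odot>\<^bsub>X\<^esub> x) \<le> norm c * vnorm G a"
      using a Q_smult[OF a(1)] vnorm_Q_le[of "c \<odot>\<^bsub>G\<^esub> a"] by (simp add: E.vnorm_smult)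
    also have "\<dots> \<le> norm c * (vnorm X x + e / (norm c + 1))"
      using a(3) by (intro mult_left_mono) auto
    also have "\<dots> \<le> norm c * vnorm X x + e"
    proof -
      have "norm c * (e / (norm c + 1)) \<le> (norm c + 1) * (e / (norm c + 1))"
        using e by (intro mult_right_mono) auto
      also have "\<dots> = e" by (simp add: add_nonneg_pos[THEN less_imp_neq, symmetric])
      finally show ?thesis by (simp add: distrib_left)
    qed
    finally show "vnorm X (c \<odot>\<^bsub>X\<^esub> x) \<le> norm c * vnorm X x + e" .
  qed
  show "vnorm X (c \<odot>\<^bsub>X\<^esub> x) = norm c * vnorm X x" if x: "x \<in> Q ` carrier G" for c x
  proof (cases "c = 0")
    case True
    obtain a where a: "a \<in> carrier G" "x = Q a" using x by auto
    have z: "c \<odot>\<^bsub>X\<^esub> x = Q \<zero>\<^bsub>G\<^esub>" using True a E.smult_l_null[OF a(1)] by (simp add: Q_smult)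
    have "0 \<le> vnorm X (Q \<zero>\<^bsub>G\<^esub>)" by (rule vnorm_X_ge) (auto intro: E.vnorm_nonneg)
    then have "vnorm X (Q \<zero>\<^bsub>G\<^esub>) = 0" using vnorm_Q_le[of "\<zero>\<^bsub>G\<^esub>"] by simp
    then show ?thesis using z True by simp
  next
    case False
    obtain a where a: "a \<in> carrier G" "x = Q a" using x by auto
    \<comment> \<open>The reverse inequality is \<open>smult_le\<close> for the inverse
      scalar.\<close>
    have "inverse c \<odot>\<^bsub>X\<^esub> (c \<odot>\<^bsub>X\<^esub> x) = x"
      using a False E.smult_assoc1[of "inverse c" c a] E.smult_one[OF a(1)] by (simp add: Q_smult)
    then have "vnorm X x \<le> norm (inverse c) * vnorm X (c \<odot>\<^bsub>X\<^esub> x)"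
      using smult_le[of "c \<odot>\<^bsub>X\<^esub> x" "inverse c"] a by (simp add: Q_smult)
    then have "norm c * vnorm X x \<le> norm c * (norm (inverse c) * vnorm X (c \<odot>\<^bsub>X\<^esub> x))"
      by (rule mult_left_mono) simp
    also have "\<dots> = vnorm X (c \<odot>\<^bsub>X\<^esub> x)"
      unfolding norm_inverse mult.assoc[symmetric] using False by simp
    finally show ?thesis using smult_le[OF x, of c] by (rule antisym[rotated])
  qed
qed

sublocale X: normed_space X by (rule normed_space_X)

sublocale Q: bounded_op G X Q
  by unfold_locales
    (auto simp: bounded_operator_def Q_add Q_smult intro!: exI[of _ 1] vnorm_Q_le)

text \<open>Representatives within \<open>(1/2)^n\<close> of the quotient norm keep a series
  absolutely summable, so it converges in \<open>G\<close>, and the bounded map \<open>Q\<close>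
  carries the sum over.\<close>

lemma banach_space_X: "banach_space X"
proof (rule X.banach_spaceI)
  interpret G: banach_space G by (rule banach)
  fix x assume x: "\<And>n. x n \<in> carrier X" and sm: "summable (\<lambda>n. vnorm X (x n))"
  have "\<exists>a. a \<in> carrier G \<and> Q a = x n \<and> vnorm G a < vnorm X (x n) + (1/2)^n" for n :: nat
    using obtain_repr[OF x, of "(1/2)^n" n] by (metis zero_less_power half_gt_zero zero_less_one)
  then obtain a where a: "\<And>n. a n \<in> carrier G" "\<And>n. Q (a n) = x n"
    "\<And>n. vnorm G (a n) < vnorm X (x n) + (1/2)^n" by metis
  have "summable (\<lambda>n. vnorm X (x n) + (1/2)^n)"
    using sm by (intro summable_add) (auto simp: summable_geometric)
  then have "summable (\<lambda>n. vnorm G (a n))"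
    by (rule summable_comparison_test'[where N=0])
      (use a in \<open>auto simp: E.vnorm_nonneg less_imp_le\<close>)
  then obtain s where "vsums G a s" using G.abs_summable_vsums a(1) by blast
  from Q.vsums[OF a(1) this] show "\<exists>s. vsums X x s" unfolding a(2) by blast
qed

text \<open>The universal property of the quotient. Since the quotient norm is the infimum over the
  fibre, the constant \<open>C\<close> is preserved. It produces both \<open>T\<^sub>0\<close> and
  \<open>S\<close>.\<close>

lemma lift:
  assumes "bounded_op G H A" and C: "\<And>a. a \<in> carrier G \<Longrightarrow> vnorm H (A a) \<le> C * vnorm G a" "0 \<le> C"
    and ker: "\<And>a b. a \<in> carrier G \<Longrightarrow> b \<in> carrier G \<Longrightarrow> \<theta> a = \<theta> b \<Longrightarrow> A a = A b"
  obtains L where "bounded_operator X H L" "\<And>a. a \<in> carrier G \<Longrightarrow> L (Q a) = A a"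
    "\<And>x. x \<in> carrier X \<Longrightarrow> vnorm H (L x) \<le> C * vnorm X x"
proof -
  interpret A: bounded_op G H A by fact
  define L where "L x = A (inv_into (carrier G) Q x)" for x
  have L: "L (Q a) = A a" if "a \<in> carrier G" for a
    unfolding L_def using repr that by (intro ker) auto
  have le: "vnorm H (L x) \<le> C * vnorm X x" if x: "x \<in> carrier X" for x
  proof (cases "C = 0")
    case True
    then show ?thesis using C(1) x L by (auto simp: carrier_X)
  next
    case False
    then have "0 < C" using C(2) by simp
    have "vnorm H (L x) / C \<le> vnorm X x"
    proof (rule vnorm_X_ge[OF x])
      fix a assume a: "a \<in> carrier G" "Q a = x"
      then show "vnorm H (L x) / C \<le> vnorm G a"
        using C(1)[OF a(1)] L[OF a(1)] \<open>0 < C\<close> by (simp add: field_simps)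
    qed
    then show ?thesis using \<open>0 < C\<close> by (simp add: field_simps)
  qed
  have "bounded_operator X H L"
    unfolding bounded_operator_def
  proof (intro conjI exI[of _ C])
    show "\<forall>x\<in>carrier X. vnorm H (L x) \<le> C * vnorm X x" using le by blast
  qed (auto simp: carrier_X Q_add Q_smult L A.add A.smult)
  then show thesis using that L le by blast
qed

text \<open>Preimages of T x under \<theta> are not unique, but they share one class, and passing to
  this class is linear in x. The control on the unit ball extends by scaling. This produces
  \<open>R\<close>; the last conclusion supplies the representatives that bound its norm.\<close>

lemma colift:
  assumes "bounded_op E F T" and C: "\<And>x. x \<in> unit_ball E \<Longrightarrow> \<exists>a\<in>carrier G. \<theta> a = T x \<and> vnorm G a \<le> C"
  obtains R where "bounded_operator E X R"
    "\<And>x a. x \<in> carrier E \<Longrightarrow> a \<in> carrier G \<Longrightarrow> \<theta> a = T x \<Longrightarrow> R x = Q a"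
    "\<And>x. x \<in> carrier E \<Longrightarrow> \<exists>a\<in>carrier G. \<theta> a = T x \<and> vnorm G a \<le> C * vnorm E x"
proof -
  interpret T: bounded_op E F T by fact
  have ex: "\<exists>a\<in>carrier G. \<theta> a = T x \<and> vnorm G a \<le> C * vnorm E x" if x: "x \<in> carrier E" for x
  proof (cases "vnorm E x = 0")
    case True
    then have "x = \<zero>\<^bsub>E\<^esub>" using T.E.vnorm_eq_0[OF x] by simp
    then show ?thesis by (intro bexI[of _ "\<zero>\<^bsub>G\<^esub>"]) auto
  next
    case False
    then have pos: "0 < vnorm E x" using T.E.vnorm_nonneg[OF x] by simp
    let ?c = "of_real (vnorm E x) :: 'k"
    have c: "?c \<noteq> 0" using pos by simp
    have "inverse ?c \<odot>\<^bsub>E\<^esub> x \<in> unit_ball E"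
      using x pos by (simp add: unit_ball_def T.E.vnorm_smult norm_inverse)
    then obtain a where a: "a \<in> carrier G" "\<theta> a = T (inverse ?c \<odot>\<^bsub>E\<^esub> x)" "vnorm G a \<le> C"
      using C by blast
    have "\<theta> (?c \<odot>\<^bsub>G\<^esub> a) = T (?c \<odot>\<^bsub>E\<^esub> (inverse ?c \<odot>\<^bsub>E\<^esub> x))"
      using a x by (simp add: smult T.smult)
    also have "?c \<odot>\<^bsub>E\<^esub> (inverse ?c \<odot>\<^bsub>E\<^esub> x) = x"
      using T.E.smult_assoc1[of ?c "inverse ?c" x] T.E.smult_one[OF x] x c by simp
    finally have "\<theta> (?c \<odot>\<^bsub>G\<^esub> a) = T x" .
    moreover have "vnorm G (?c \<odot>\<^bsub>G\<^esub> a) \<le> C * vnorm E x"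
      using a pos by (simp add: E.vnorm_smult mult.commute)
    ultimately show ?thesis using a by (intro bexI[of _ "?c \<odot>\<^bsub>G\<^esub> a"]) auto
  qed
  define R where "R x = Q (inv_into (carrier G) \<theta> (T x))" for x
  have R: "R x = Q a" if "x \<in> carrier E" "a \<in> carrier G" "\<theta> a = T x" for x a
  proof -
    have "T x \<in> \<theta> ` carrier G" using that by (metis imageI)
    then have "inv_into (carrier G) \<theta> (T x) \<in> carrier G" "\<theta> (inv_into (carrier G) \<theta> (T x)) = T x"
      by (auto intro: inv_into_into f_inv_into_f)
    then show ?thesis unfolding R_def using that Q_eq_iff by auto
  qed
  have "bounded_operator E X R"
    unfolding bounded_operator_def
  proof (intro conjI allI ballI Pi_I)
    fix x assume x: "x \<in> carrier E"
    obtain a where a: "a \<in> carrier G" "\<theta> a = T x" using ex[OF x] by blast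
    show "R x \<in> carrier X" using R[OF x a] a by simp
    fix c show "R (c \<odot>\<^bsub>E\<^esub> x) = c \<odot>\<^bsub>X\<^esub> R x"
      using R[OF x a] R[of "c \<odot>\<^bsub>E\<^esub> x" "c \<odot>\<^bsub>G\<^esub> a"] a x by (simp add: Q_smult smult T.smult)
    fix y assume y: "y \<in> carrier E"
    obtain b where b: "b \<in> carrier G" "\<theta> b = T y" using ex[OF y] by blast
    show "R (x \<oplus>\<^bsub>E\<^esub> y) = R x \<oplus>\<^bsub>X\<^esub> R y"
      using R[OF x a] R[OF y b] R[of "x \<oplus>\<^bsub>E\<^esub> y" "a \<oplus>\<^bsub>G\<^esub> b"] a b x y by (simp add: Q_add add T.add)
  next
    have "vnorm X (R x) \<le> C * vnorm E x" if x: "x \<in> carrier E" for x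
    proof -
      obtain a where a: "a \<in> carrier G" "\<theta> a = T x" "vnorm G a \<le> C * vnorm E x" using ex[OF x] by blast
      then show ?thesis using R[OF x a(1,2)] vnorm_Q_le[OF a(1)] by simp
    qed
    then show "\<exists>C. \<forall>x\<in>carrier E. vnorm X (R x) \<le> C * vnorm E x" by blast
  qed
  then show thesis using that R ex by blast
qed

end

section \<open>Compact and \<open>p\<close>-compact operators\<close>

lemma bounded_operator_comp:
  assumes "bounded_op E F A" "bounded_op F H B"
  shows "bounded_op E H (\<lambda>x. B (A x))"
proof -
  interpret A: bounded_op E F A by fact
  interpret B: bounded_op F H B by fact
  have "vnorm H (B (A x)) \<le> (op_norm F H B * op_norm E F A) * vnorm E x" if "x \<in> carrier E" for x
  proof -
    have "vnorm H (B (A x)) \<le> op_norm F H B * vnorm F (A x)" using that by (intro B.le_op_norm) auto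
    also have "\<dots> \<le> op_norm F H B * (op_norm E F A * vnorm E x)"
      using that by (intro mult_left_mono A.le_op_norm B.op_norm_nonneg)
    finally show ?thesis by (simp add: mult.assoc)
  qed
  then show ?thesis
    by unfold_locales
      (auto simp: bounded_operator_def A.add A.smult B.add B.smult
        intro!: exI[of _ "op_norm F H B * op_norm E F A"])
qed

lemma kappa_bdd_below:
  assumes "normed_space F"
  shows "bdd_below {lp_norm p F x | x. x \<in> lp p F \<and> T ` unit_ball E \<subseteq> p_co p F x}"
proof -
  interpret normed_space F by fact
  show ?thesis
    by (auto intro!: bdd_belowI[of _ 0] lseq_norm_nonneg simp: lp_norm_eq lp_iff)
qed

lemma kappa_le:
  assumes "normed_space F" "x \<in> lp p F" "T ` unit_ball E \<subseteq> p_co p F x"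
  shows "kappa p E F T \<le> lp_norm p F x"
  unfolding kappa_def by (rule cInf_lower[OF _ kappa_bdd_below]) (use assms in auto)

lemma kappa_nonneg:
  assumes "p_compact_operator p E F T" "normed_space F"
  shows "0 \<le> kappa p E F T"
  unfolding kappa_def
proof (rule cInf_greatest)
  interpret normed_space F by fact
  show "{lp_norm p F x |x. x \<in> lp p F \<and> T ` unit_ball E \<subseteq> p_co p F x} \<noteq> {}"
    using assms by (auto simp: p_compact_operator_def)
  show "0 \<le> t" if "t \<in> {lp_norm p F x |x. x \<in> lp p F \<and> T ` unit_ball E \<subseteq> p_co p F x}" for t
    using that by (auto intro!: lseq_norm_nonneg simp: lp_norm_eq lp_iff)
qed

lemma kappa_less:
  assumes "p_compact_operator p E F T" "normed_space F" "kappa p E F T < t"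
  obtains x where "x \<in> lp p F" "T ` unit_ball E \<subseteq> p_co p F x" "lp_norm p F x < t"
proof -
  have "{lp_norm p F x |x. x \<in> lp p F \<and> T ` unit_ball E \<subseteq> p_co p F x} \<noteq> {}"
    using assms by (auto simp: p_compact_operator_def)
  from cInf_lessD[OF this assms(3)[unfolded kappa_def]] show thesis using that by auto
qed

text \<open>\<open>R\<close> maps the unit ball of \<open>E\<close> into the unit ball of
  \<open>X\<close> scaled by the norm of \<open>R\<close>. Hence the images under \<open>S\<close>
  of the \<open>x n\<close>, multiplied by that norm, work for the composition with unchanged
  coefficients.\<close>

lemma p_compact_comp:
  fixes E :: "('k::{real_normed_field,euclidean_space}, 'e) normed_module"
    and F :: "('k, 'f) normed_module"
  assumes "bounded_op E X R" "bounded_op X Y T" "bounded_op Y F S"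
    and p: "1 \<le> p" and T: "T ` unit_ball X \<subseteq> p_co p Y x" "x \<in> lp p Y"
  obtains y where "y \<in> lp p F" "(\<lambda>v. S (T (R v))) ` unit_ball E \<subseteq> p_co p F y"
    "lp_norm p F y \<le> op_norm Y F S * lp_norm p Y x * op_norm E X R"
proof -
  interpret R: bounded_op E X R by fact
  interpret T: bounded_op X Y T by fact
  interpret S: bounded_op Y F S by fact
  let ?r = "op_norm E X R" and ?s = "op_norm Y F S"
  let ?c = "of_real ?r :: 'k"
  have x: "\<And>n. x n \<in> carrier Y" "lseq p (\<lambda>n. vnorm Y (x n))" using T(2) T.F.lp_iff by auto
  define y where "y n = ?c \<odot>\<^bsub>F\<^esub> S (x n)" for n
  have y: "y n \<in> carrier F" for n using x by (simp add: y_def)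
  have yle: "vnorm F (y n) \<le> (?s * ?r) * vnorm Y (x n)" for n
  proof -
    have "vnorm F (y n) = ?r * vnorm F (S (x n))"
      using x R.op_norm_nonneg by (simp add: y_def S.F.vnorm_smult)
    also have "\<dots> \<le> ?r * (?s * vnorm Y (x n))"
      using x R.op_norm_nonneg by (intro mult_left_mono S.le_op_norm)
    finally show ?thesis by (simp add: mult_ac)
  qed
  have c: "0 \<le> ?s * ?r" using R.op_norm_nonneg S.op_norm_nonneg by simp
  have "lseq p (\<lambda>n. vnorm F (y n))"
    "lseq_norm p (\<lambda>n. vnorm F (y n)) \<le> lseq_norm p (\<lambda>n. ?s * ?r * vnorm Y (x n))"
    using lseq_mono[OF p lseq_scale(1)[OF p x(2) c] _ yle] S.F.vnorm_nonneg[OF y] by auto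
  then have ylp: "y \<in> lp p F" "lp_norm p F y \<le> ?s * lp_norm p Y x * ?r"
    using y lseq_scale(2)[OF p x(2) c] by (auto simp: S.F.lp_iff lp_norm_eq mult_ac)
  have "S (T (R v)) \<in> p_co p F y" if v: "v \<in> unit_ball E" for v
  proof (cases "?r = 0")
    case True
    have vE: "v \<in> carrier E" using v by (simp add: unit_ball_def)
    have "vnorm X (R v) = 0"
      using R.le_op_norm[OF vE] True R.F.vnorm_nonneg[of "R v"] vE by simp
    then have "R v = \<zero>\<^bsub>X\<^esub>" using R.F.vnorm_eq_0 vE by simp
    then show ?thesis using p_co_zero[OF S.F.normed_space_axioms y] by simp
  next
    case False
    then have r: "0 < ?r" using R.op_norm_nonneg by simp
    then have c: "?c \<noteq> 0" by simp
    have vE: "v \<in> carrier E" using v by (simp add: unit_ball_def)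
    let ?w = "inverse ?c \<odot>\<^bsub>X\<^esub> R v"
    have "?w \<in> unit_ball X"
      using R.le_op_norm_unit[OF v] r vE
      by (simp add: unit_ball_def R.F.vnorm_smult norm_inverse) (simp add: field_simps)
    then have "T ?w \<in> p_co p Y x" using T(1) by blast
    then obtain \<alpha> where a: "\<alpha> \<in> lp (conj_exp p) (scalars :: ('k, 'k) normed_module)"
      "lp_norm (conj_exp p) (scalars :: ('k, 'k) normed_module) \<alpha> \<le> 1"
      "vsums Y (\<lambda>n. \<alpha> n \<odot>\<^bsub>Y\<^esub> x n) (T ?w)" unfolding p_co_def by blast
    have "bounded_operator F F (\<lambda>z. ?c \<odot>\<^bsub>F\<^esub> z)"
      using S.F.smult_r_distr[of ?c]
      by (auto simp: bounded_operator_def S.F.vnorm_smult S.F.smult_assoc1[of _ _ , simplified, symmetric] mult.commute intro!: exI[of _ "norm ?c"])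
    then interpret m: bounded_op F F "\<lambda>z. ?c \<odot>\<^bsub>F\<^esub> z" by unfold_locales
    interpret Sm: bounded_op Y F "\<lambda>z. ?c \<odot>\<^bsub>F\<^esub> S z"
      by (rule bounded_operator_comp[OF S.bounded_op_axioms m.bounded_op_axioms])
    have "vsums F (\<lambda>n. \<alpha> n \<odot>\<^bsub>F\<^esub> y n) (?c \<odot>\<^bsub>F\<^esub> S (T ?w))"
      using Sm.vsums[OF _ a(3)] x by (simp add: Sm.smult y_def)
    moreover have "?c \<odot>\<^bsub>F\<^esub> S (T ?w) = S (T (R v))"
    proof -
      have "?c \<odot>\<^bsub>F\<^esub> S (T ?w) = ?c \<odot>\<^bsub>F\<^esub> (inverse ?c \<odot>\<^bsub>F\<^esub> S (T (R v)))"
        using vE by (simp add: T.smult S.smult)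
      also have "\<dots> = S (T (R v))"
        using S.F.smult_assoc1[of ?c "inverse ?c" "S (T (R v))"] S.F.smult_one vE c by simp
      finally show ?thesis .
    qed
    ultimately show ?thesis using a(1,2) unfolding p_co_def by force
  qed
  then show thesis using that ylp by blast
qed

text \<open>Coefficients bounded by \<open>M\<close> range over a ball of the finite-dimensional
  field 'k, which is compact. The approximating sums therefore have finite nets, and completeness
  turns total boundedness into a compact closure.\<close>

lemma relatively_compactI:
  fixes E :: "('k::{real_normed_field,euclidean_space}, 'a) normed_module" (structure)
  assumes "banach_space E" and A: "A \<subseteq> carrier E"
    and appr: "\<And>e. 0 < e \<Longrightarrow> \<exists>N v. (\<forall>n. v n \<in> carrier E) \<and>
      (\<forall>x\<in>A. \<exists>b. (\<forall>n. norm (b n) \<le> M) \<and> vnorm E (x \<ominus> finsum E (\<lambda>n. b n \<odot> v n) {..<N::nat}) < e)"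
  shows "compactin (vtopology E) (vtopology E closure_of A)"
proof -
  interpret banach_space E by fact
  have "mtotally_bounded A"
    unfolding mtotally_bounded_def
  proof (intro allI impI)
    fix e :: real assume e: "0 < e"
    then have "0 < e / 4" by simp
    from appr[OF this] obtain N v where v: "\<And>n. v n \<in> carrier E"
      and ap: "\<And>x. x \<in> A \<Longrightarrow> \<exists>b. (\<forall>n. norm (b n) \<le> M) \<and> vnorm E (x \<ominus> finsum E (\<lambda>n. b n \<odot> v n) {..<N::nat}) < e/4"
      by blast
    define V where "V = (\<Sum>n<N. vnorm E (v n)) + 1"
    have V: "0 < V" using v by (auto simp: V_def intro!: add_nonneg_pos sum_nonneg vnorm_nonneg)
    \<comment> \<open>Moving every coefficient by at most \<open>d\<close> changes the sum by at
      most e/4. With the approximation error this stays below e/2, and the other e/2 is kept for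
      moving the centres into \<open>A\<close>.\<close>
    define d where "d = e / 4 / V"
    have d: "0 < d" using e V by (simp add: d_def)
    obtain D where D: "finite D" "cball (0::'k) M \<subseteq> (\<Union>c\<in>D. ball c d)"
      using compact_eq_totally_bounded[of "cball (0::'k) M"] d by auto
    define K where "K = (\<lambda>b. finsum E (\<lambda>n. b n \<odot> v n) {..<N}) ` ({..<N} \<rightarrow>\<^sub>E D)"
    have K: "finite K" "K \<subseteq> carrier E" using D v by (auto simp: K_def intro!: finite_imageI finite_PiE)
    have near: "\<exists>k\<in>K. vnorm E (x \<ominus> k) < e/2" if x: "x \<in> A" for x
    proof -
      obtain b where b: "\<And>n. norm (b n) \<le> M" "vnorm E (x \<ominus> finsum E (\<lambda>n. b n \<odot> v n) {..<N}) < e/4"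
        using ap[OF x] by blast
      have "\<exists>c\<in>D. dist c (b n) < d" for n
      proof -
        have "b n \<in> cball 0 M" using b(1)[of n] by simp
        then show ?thesis using D(2) by (auto simp: subset_iff)
      qed
      then obtain c where c: "\<And>n. c n \<in> D" "\<And>n. dist (c n) (b n) < d" by metis
      define k where "k = finsum E (\<lambda>n. c n \<odot> v n) {..<N}"
      have "k = finsum E (\<lambda>n. restrict c {..<N} n \<odot> v n) {..<N}"
        unfolding k_def using v by (intro M.finsum_cong') auto
      moreover have "restrict c {..<N} \<in> {..<N} \<rightarrow>\<^sub>E D" using c by auto
      ultimately have kK: "k \<in> K" unfolding K_def by blast
      let ?s = "finsum E (\<lambda>n. b n \<odot> v n) {..<N}"
      have "?s = finsum E (\<lambda>n. (b n - c n) \<odot> v n) {..<N} \<oplus> k"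
      proof -
        have "finsum E (\<lambda>n. (b n - c n) \<odot> v n) {..<N} \<oplus> k = finsum E (\<lambda>n. (b n - c n) \<odot> v n \<oplus> c n \<odot> v n) {..<N}"
          unfolding k_def using v by (intro M.finsum_addf[symmetric]) auto
        also have "\<dots> = ?s"
        proof (intro M.finsum_cong' refl)
          fix n
          show "(b n - c n) \<odot> v n \<oplus> c n \<odot> v n = b n \<odot> v n"
            using smult_l_distr[of "b n - c n" "c n" "v n"] v by simp
        qed (use v in auto)
        finally show ?thesis ..
      qed
      then have "vnorm E (?s \<ominus> k) = vnorm E (finsum E (\<lambda>n. (b n - c n) \<odot> v n) {..<N})"
        using v by (simp add: add_minus_cancel_right k_def)
      also have "\<dots> \<le> (\<Sum>n<N. vnorm E ((b n - c n) \<odot> v n))"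
        using v by (intro vnorm_finsum_le) auto
      also have "\<dots> \<le> (\<Sum>n<N. d * vnorm E (v n))"
      proof (intro sum_mono)
        fix n
        have "norm (b n - c n) \<le> d" using c(2)[of n] by (simp add: dist_norm norm_minus_commute)
        then show "vnorm E ((b n - c n) \<odot> v n) \<le> d * vnorm E (v n)"
          using v by (simp add: vnorm_smult mult_right_mono vnorm_nonneg)
      qed
      also have "\<dots> \<le> d * V" unfolding sum_distrib_left[symmetric] V_def using d by (intro mult_left_mono) auto
      also have "\<dots> = e/4" using V by (simp add: d_def)
      finally have "vnorm E (?s \<ominus> k) \<le> e/4" .
      moreover have "vnorm E (x \<ominus> k) \<le> vnorm E (x \<ominus> ?s) + vnorm E (?s \<ominus> k)"
        using x A v by (intro vnorm_minus_triangle) (auto simp: k_def)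
      ultimately show ?thesis using b(2) kK by (intro bexI[of _ k]) auto
    qed
    \<comment> \<open>Total boundedness requires the centres of the balls to be in \<open>A\<close>.\<close>
    define K' where "K' = {k \<in> K. \<exists>x\<in>A. vnorm E (x \<ominus> k) < e/2}"
    have "\<forall>k\<in>K'. \<exists>y. y \<in> A \<and> vnorm E (y \<ominus> k) < e/2" by (auto simp: K'_def)
    from bchoice[OF this] obtain g
      where g: "\<And>k. k \<in> K' \<Longrightarrow> g k \<in> A \<and> vnorm E (g k \<ominus> k) < e/2" by blast
    have "A \<subseteq> (\<Union>y\<in>g ` K'. mball y e)"
    proof
      fix x assume x: "x \<in> A"
      obtain k where k: "k \<in> K" "vnorm E (x \<ominus> k) < e/2" using near[OF x] by blast
      then have kK: "k \<in> K'" using x by (auto simp: K'_def)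
      have m: "x \<in> carrier E" "g k \<in> carrier E" "k \<in> carrier E" using x g[OF kK] A K k by auto
      have "vnorm E (g k \<ominus> x) \<le> vnorm E (g k \<ominus> k) + vnorm E (k \<ominus> x)"
        using m by (intro vnorm_minus_triangle)
      then have "vnorm E (g k \<ominus> x) < e" using k(2) g[OF kK] vnorm_minus_commute[of k x] m by simp
      then show "x \<in> (\<Union>y\<in>g ` K'. mball y e)" using m kK by (auto simp: vdist_eq in_mball)
    qed
    moreover have "finite (g ` K')" "g ` K' \<subseteq> A" using K g by (auto simp: K'_def)
    ultimately show "\<exists>K. finite K \<and> K \<subseteq> A \<and> A \<subseteq> (\<Union>x\<in>K. mball x e)" by blast
  qed
  then show ?thesis using mtotally_bounded_eq_compact_closure_of[OF complete] by blast
qed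

lemma bounded_op_smult:
  fixes E :: "('k::{real_normed_field,euclidean_space}, 'a) normed_module"
  assumes "normed_space E"
  shows "bounded_op E E (\<lambda>x. c \<odot>\<^bsub>E\<^esub> x)"
proof -
  interpret normed_space E by fact
  have "c \<odot>\<^bsub>E\<^esub> (a \<odot>\<^bsub>E\<^esub> x) = a \<odot>\<^bsub>E\<^esub> (c \<odot>\<^bsub>E\<^esub> x)" if "x \<in> carrier E" for a x
    using smult_assoc1[of c a x] smult_assoc1[of a c x] that by (simp add: mult.commute)
  then show ?thesis
    using smult_r_distr[of c]
    by unfold_locales (auto simp: bounded_operator_def vnorm_smult intro!: exI[of _ "norm c"])
qed

lemma (in normed_space) vsums_add:
  assumes x: "\<And>n. x n \<in> carrier E" and y: "\<And>n. y n \<in> carrier E"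
    and "vsums E x s" "vsums E y t"
  shows "vsums E (\<lambda>n. x n \<oplus> y n) (s \<oplus> t)"
proof -
  have s: "s \<in> carrier E" "(\<lambda>N. vnorm E (finsum E x {..<N} \<ominus> s)) \<longlonglongrightarrow> 0"
    and t: "t \<in> carrier E" "(\<lambda>N. vnorm E (finsum E y {..<N} \<ominus> t)) \<longlonglongrightarrow> 0"
    using assms vsums_iff by auto
  have "(\<lambda>N. vnorm E (finsum E (\<lambda>n. x n \<oplus> y n) {..<N} \<ominus> (s \<oplus> t))) \<longlonglongrightarrow> 0"
  proof (rule tendsto_sandwich[OF _ _ tendsto_const[of 0]])
    show "(\<lambda>N. vnorm E (finsum E x {..<N} \<ominus> s) + vnorm E (finsum E y {..<N} \<ominus> t)) \<longlonglongrightarrow> 0"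
      using tendsto_add[OF s(2) t(2)] by simp
  qed (use x y s t in \<open>auto intro!: always_eventually vnorm_triangle vnorm_nonneg
    simp: M.finsum_addf minus_eq_add_minus\<close>)
  then show ?thesis using x y s t by (subst vsums_iff) auto
qed

section \<open>Diagonal operators, unit vectors and summation operators\<close>

definition diag :: "(nat \<Rightarrow> real) \<Rightarrow> (nat \<Rightarrow> 'k) \<Rightarrow> nat \<Rightarrow> 'k::real_normed_field" where
  "diag m a = (\<lambda>n. of_real (m n) * a n)"

lemma diag_bounded_op:
  assumes q: "1 \<le> q" "1 \<le> r"
    and C: "\<And>a :: nat \<Rightarrow> 'k. lseq q (\<lambda>n. norm (a n)) \<Longrightarrow> lseq r (\<lambda>n. norm (diag m a n)) \<and>
       lseq_norm r (\<lambda>n. norm (diag m a n)) \<le> C * lseq_norm q (\<lambda>n. norm (a n))"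
  shows "bounded_op (seqsp q) (seqsp r :: ('k::{real_normed_field,euclidean_space}, nat \<Rightarrow> 'k) normed_module) (diag m)"
proof -
  have "bounded_operator (seqsp q) (seqsp r :: ('k, nat \<Rightarrow> 'k) normed_module) (diag m)"
    unfolding bounded_operator_def
  proof (intro conjI exI[of _ C])
    show "\<forall>a\<in>carrier (seqsp q). vnorm (seqsp r) (diag m a :: nat \<Rightarrow> 'k) \<le> C * vnorm (seqsp q) a"
      using C by (simp add: seqsp_simps)
  qed (use C in \<open>auto simp: seqsp_simps, auto simp: diag_def algebra_simps\<close>)
  then show ?thesis
    using normed_space_seqsp q by (auto simp: bounded_op_def bounded_op_axioms_def)
qed

text \<open>Besides d = 1 for the multiplier \<mu> itself, a small \<open>d\<close> is used for
  \<mu> with its first entries replaced by 0; this gives the error estimate behind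
  compactness.\<close>

lemma diag_contraction:
  assumes q: "1 \<le> q" and m: "\<And>n. 0 \<le> m n" "\<And>n. m n \<le> d" and a: "lseq q (\<lambda>n. norm (a n :: 'k::real_normed_field))"
  shows "lseq q (\<lambda>n. norm (diag m a n))"
    "lseq_norm q (\<lambda>n. norm (diag m a n)) \<le> d * lseq_norm q (\<lambda>n. norm (a n))"
proof -
  have d: "0 \<le> d" using m[of 0] by simp
  have "norm (diag m a n) \<le> d * norm (a n)" for n
    using m by (simp add: diag_def norm_mult mult_right_mono)
  from lseq_mono[OF q lseq_scale(1)[OF q a d] _ this] lseq_scale(2)[OF q a d]
  show "lseq q (\<lambda>n. norm (diag m a n))"
    "lseq_norm q (\<lambda>n. norm (diag m a n)) \<le> d * lseq_norm q (\<lambda>n. norm (a n))" by auto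
qed

lemma diag_Holder:
  assumes p: "1 \<le> p" and s: "lseq p s" and a: "lseq (conj_exp p) (\<lambda>n. norm (a n :: 'k::real_normed_field))"
  shows "lseq 1 (\<lambda>n. norm (diag s a n))"
    "lseq_norm 1 (\<lambda>n. norm (diag s a n)) \<le> lseq_norm p s * lseq_norm (conj_exp p) (\<lambda>n. norm (a n))"
proof -
  have "(\<lambda>n. norm (diag s a n)) = (\<lambda>n. s n * norm (a n))"
    using lseq_nonneg[OF s] by (simp add: diag_def norm_mult)
  then show "lseq 1 (\<lambda>n. norm (diag s a n))"
    "lseq_norm 1 (\<lambda>n. norm (diag s a n)) \<le> lseq_norm p s * lseq_norm (conj_exp p) (\<lambda>n. norm (a n))"
    using lseq_Holder[OF p s a] by simp_all
qed

definition unit_seq :: "nat \<Rightarrow> nat \<Rightarrow> 'k::real_normed_field" where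
  "unit_seq n = (\<lambda>i. if i = n then 1 else 0)"

lemma unit_seq_norm: "lseq 1 (\<lambda>i. norm (unit_seq n i :: 'k::real_normed_field))"
  "lseq_norm 1 (\<lambda>i. norm (unit_seq n i :: 'k)) \<le> 1"
proof -
  have "(\<Sum>i<N. norm (unit_seq n i :: 'k)) \<le> 1" for N
    by (simp add: unit_seq_def if_distrib[of norm] cong: if_cong)
  then show "lseq 1 (\<lambda>i. norm (unit_seq n i :: 'k))" "lseq_norm 1 (\<lambda>i. norm (unit_seq n i :: 'k)) \<le> 1"
    using lseq_1I[of "\<lambda>i. norm (unit_seq n i :: 'k)" 1] by auto
qed

lemma lseq_finite_support:
  assumes "1 \<le> q" "\<And>n. 0 \<le> a n" "\<And>n. n \<ge> N \<Longrightarrow> a n = 0"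
  shows "lseq q a"
  using assms(1)
proof (cases rule: ereal_ge_1_cases)
  case (1 r)
  have "summable (\<lambda>n. a n powr r)"
    by (rule summable_finite[of "{..<N}"]) (use assms(3) in auto)
  then show ?thesis using 1 assms(2) by (simp add: lseq_real)
next
  case 2
  have "\<forall>\<^sub>F n in sequentially. a n = 0" using assms(3) by (auto simp: eventually_sequentially)
  then have "a \<longlonglongrightarrow> 0" by (rule tendsto_eventually)
  then show ?thesis using 2 assms(2) by (simp add: lseq_PInf)
qed

lemma unit_seq_carrier: "1 \<le> q \<Longrightarrow> unit_seq n \<in> carrier (seqsp q)"
  by (auto simp: seqsp_simps unit_seq_def intro: lseq_finite_support[of q _ "Suc n"])

lemma finsum_unit_seq:
  assumes q: "1 \<le> q"
  shows "finsum (seqsp q) (\<lambda>n. b n \<odot>\<^bsub>seqsp q\<^esub> unit_seq n) {..<N}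
    = (\<lambda>i. if i < N then b i else (0 :: 'k::{real_normed_field,euclidean_space}))"
proof -
  interpret normed_space "seqsp q :: ('k, nat \<Rightarrow> 'k) normed_module"
    using q by (rule normed_space_seqsp)
  have c: "b n \<odot>\<^bsub>seqsp q\<^esub> unit_seq n \<in> carrier (seqsp q)" for n
    by (intro smult_closed) (simp_all add: unit_seq_carrier[OF q])
  show ?thesis
    unfolding seqsp_finsum[OF q c]
    by (auto simp: seqsp_simps unit_seq_def fun_eq_iff if_distrib[of "(*) _"] cong: if_cong)
qed

text \<open>The remainder after N terms is the tail of the absolutely convergent norm series. Pushed
  to the quotient of l_1, this expansion exhibits the values of \<open>T\<^sub>0\<close> as elements
  of a p-convex hull.\<close>

lemma vsums_unit_seq:
  assumes a: "a \<in> carrier (seqsp 1)"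
  shows "vsums (seqsp 1) (\<lambda>n. a n \<odot>\<^bsub>seqsp 1\<^esub> unit_seq n) (a :: nat \<Rightarrow> 'k::{real_normed_field,euclidean_space})"
proof -
  interpret normed_space "seqsp 1 :: ('k, nat \<Rightarrow> 'k) normed_module"
    by (rule normed_space_seqsp) simp
  let ?f = "\<lambda>n. norm (a n)"
  have f: "summable ?f" using a by (simp add: seqsp_simps lseq_1)
  have c: "a n \<odot>\<^bsub>seqsp 1\<^esub> unit_seq n \<in> carrier (seqsp 1)" for n
    by (intro smult_closed) (simp_all add: unit_seq_carrier)
  let ?P = "\<lambda>N i. if i < N then a i else 0"
  have "vnorm (seqsp 1) (?P N \<ominus>\<^bsub>seqsp 1\<^esub> a) = (\<Sum>n. ?f n) - (\<Sum>n<N. ?f n)" for N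
  proof -
    have P: "?P N \<in> carrier (seqsp 1)"
      by (auto simp: seqsp_simps intro: lseq_finite_support[of 1 _ N])
    have "?P N \<ominus>\<^bsub>seqsp 1\<^esub> a = (\<lambda>i. ?P N i - a i)" using seqsp_minus[OF _ P a] by simp
    moreover have "lseq 1 (\<lambda>i. norm (?P N i - a i))"
      using calculation P a minus_closed'[OF P a] by (simp add: seqsp_simps(1))
    ultimately have "vnorm (seqsp 1) (?P N \<ominus>\<^bsub>seqsp 1\<^esub> a) = (\<Sum>i. norm (?P N i - a i))"
      by (simp add: seqsp_simps(5) lseq_norm_1)
    also have "(\<lambda>i. norm (?P N i - a i)) = (\<lambda>i. ?f i - (if i < N then ?f i else 0))" by auto
    also have "(\<Sum>i. ?f i - (if i < N then ?f i else 0)) = (\<Sum>i. ?f i) - (\<Sum>i. if i < N then ?f i else 0)"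
      by (intro suminf_diff[symmetric] f summable_finite[of "{..<N}"]) auto
    also have "(\<Sum>i. if i < N then ?f i else 0) = (\<Sum>i<N. ?f i)"
      by (subst suminf_finite[of "{..<N}"]) auto
    finally show ?thesis .
  qed
  moreover have "(\<lambda>N. (\<Sum>n. ?f n) - (\<Sum>n<N. ?f n)) \<longlonglongrightarrow> 0"
    using tendsto_diff[OF tendsto_const summable_LIMSEQ[OF f], of "suminf ?f"] by simp
  ultimately show ?thesis
    using a by (subst vsums_iff[OF c]) (simp add: finsum_unit_seq)
qed

text \<open>Vectors in the unit ball make the series absolutely convergent for l_1 coefficients;
  linearity then follows from uniqueness of sums.\<close>

lemma series_op:
  fixes F :: "('k::{real_normed_field,euclidean_space}, 'f) normed_module"
  assumes "banach_space F" and v: "\<And>n. v n \<in> carrier F" "\<And>n. vnorm F (v n) \<le> 1"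
  obtains \<theta> where "bounded_op (seqsp 1) F \<theta>"
    "\<And>a. a \<in> carrier (seqsp 1) \<Longrightarrow> vnorm F (\<theta> a) \<le> vnorm (seqsp 1) a"
    "\<And>a. a \<in> carrier (seqsp 1) \<Longrightarrow> vsums F (\<lambda>n. a n \<odot>\<^bsub>F\<^esub> v n) (\<theta> a)"
proof -
  interpret F: banach_space F by fact
  let ?l = "seqsp 1 :: ('k, nat \<Rightarrow> 'k) normed_module"
  have le: "vnorm F (a n \<odot>\<^bsub>F\<^esub> v n) \<le> norm (a n)" for a n
    using v(2)[of n] mult_left_mono[of "vnorm F (v n)" 1 "norm (a n)"] by (simp add: F.vnorm_smult v)
  have sm: "summable (\<lambda>n. vnorm F (a n \<odot>\<^bsub>F\<^esub> v n))" if "a \<in> carrier ?l" for a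
    by (rule summable_comparison_test'[where g="\<lambda>n. norm (a n)" and N=0])
      (use that le v in \<open>auto simp: seqsp_simps lseq_1 F.vnorm_nonneg\<close>)
  have c: "a n \<odot>\<^bsub>F\<^esub> v n \<in> carrier F" for a n using v by simp
  have "\<exists>s. vsums F (\<lambda>n. a n \<odot>\<^bsub>F\<^esub> v n) s" if "a \<in> carrier ?l" for a
    using F.abs_summable_vsums[OF c[of a] sm[OF that]] by blast
  then obtain \<theta> where \<theta>: "\<And>a. a \<in> carrier ?l \<Longrightarrow> vsums F (\<lambda>n. a n \<odot>\<^bsub>F\<^esub> v n) (\<theta> a)"
    by metis
  have bd: "vnorm F (\<theta> a) \<le> vnorm ?l a" if a: "a \<in> carrier ?l" for a
  proof -
    have "vnorm F (\<theta> a) \<le> (\<Sum>n. vnorm F (a n \<odot>\<^bsub>F\<^esub> v n))"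
      by (rule F.vsums_norm_le[OF c[of a] \<theta>[OF a] sm[OF a]])
    also have "\<dots> \<le> (\<Sum>n. norm (a n))"
      using a by (intro suminf_le le sm) (auto simp: seqsp_simps lseq_1)
    finally show ?thesis using a by (simp add: seqsp_simps lseq_norm_1)
  qed
  interpret l: normed_space ?l by (rule normed_space_seqsp) simp
  have "bounded_operator ?l F \<theta>"
    unfolding bounded_operator_def
  proof (intro conjI ballI allI exI[of _ 1] Pi_I)
    fix a assume a: "a \<in> carrier ?l"
    show "\<theta> a \<in> carrier F" using \<theta>[OF a] F.vsums_iff[OF c[of a]] by auto
    show "vnorm F (\<theta> a) \<le> 1 * vnorm ?l a" using bd[OF a] by simp
    fix k
    interpret m: bounded_op F F "\<lambda>x. k \<odot>\<^bsub>F\<^esub> x" by (rule bounded_op_smult) unfold_locales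
    have "k \<odot>\<^bsub>F\<^esub> (a n \<odot>\<^bsub>F\<^esub> v n) = (k \<odot>\<^bsub>?l\<^esub> a) n \<odot>\<^bsub>F\<^esub> v n" for n
      using F.smult_assoc1[of k "a n" "v n"] v by (simp add: seqsp_simps)
    then show "\<theta> (k \<odot>\<^bsub>?l\<^esub> a) = k \<odot>\<^bsub>F\<^esub> \<theta> a"
      using m.vsums[OF c[of a] \<theta>[OF a]] \<theta>[of "k \<odot>\<^bsub>?l\<^esub> a"] a F.vsums_unique by simp
    fix b assume b: "b \<in> carrier ?l"
    have "a n \<odot>\<^bsub>F\<^esub> v n \<oplus>\<^bsub>F\<^esub> b n \<odot>\<^bsub>F\<^esub> v n = (a \<oplus>\<^bsub>?l\<^esub> b) n \<odot>\<^bsub>F\<^esub> v n" for n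
      using F.smult_l_distr[of "a n" "b n" "v n"] v by (simp add: seqsp_simps)
    then show "\<theta> (a \<oplus>\<^bsub>?l\<^esub> b) = \<theta> a \<oplus>\<^bsub>F\<^esub> \<theta> b"
      using F.vsums_add[OF c[of a] c[of b] \<theta>[OF a] \<theta>[OF b]] \<theta>[of "a \<oplus>\<^bsub>?l\<^esub> b"] a b F.vsums_unique by simp
  qed
  then have "bounded_op ?l F \<theta>" by unfold_locales
  then show thesis using that bd \<theta> by blast
qed

text \<open>Cutting off the multiplier after N terms leaves a combination of the vectors
  \<open>A (unit_seq n)\<close> with coefficients bounded by \<open>c\<close>, and the error is
  controlled by the remaining values of \<mu>. This covers \<open>R\<close>, with \<open>A\<close> a
  quotient map, as well as \<open>S\<close>, with \<open>A\<close> a summation operator.\<close>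

lemma compact_operator_through_diag:
  fixes X :: "('k::{real_normed_field,euclidean_space}, 'x) normed_module"
  assumes q: "1 \<le> q" and "banach_space X" and "bounded_op (seqsp q) X A"
    and R: "bounded_operator E X R"
    and mu: "\<And>n. 0 \<le> \<mu> n" "\<And>n. \<mu> n \<le> 1" "\<mu> \<longlonglongrightarrow> 0"
    and fac: "\<And>x. x \<in> unit_ball E \<Longrightarrow>
      \<exists>a\<in>carrier (seqsp q). vnorm (seqsp q) a \<le> c \<and> R x = A (diag \<mu> a)"
  shows "compact_operator E X R"
proof -
  interpret X: banach_space X by fact
  interpret A: bounded_op "seqsp q" X A by fact
  let ?M = "\<bar>c\<bar>"
  have "compactin (vtopology X) (vtopology X closure_of (R ` unit_ball E))"
  proof (rule relatively_compactI[OF \<open>banach_space X\<close>, where M="?M"])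
    show "R ` unit_ball E \<subseteq> carrier X" using R by (auto simp: bounded_operator_def unit_ball_def)
    fix e :: real assume e: "0 < e"
    \<comment> \<open>The added ones keep \<open>K\<close> positive; an error of at most
      \<open>d * K\<close>, that is e/2, results.\<close>
    define K where "K = (op_norm (seqsp q) X A + 1) * (?M + 1)"
    have K: "0 < K" using A.op_norm_nonneg by (simp add: K_def)
    define d where "d = e / 2 / K"
    have d: "0 < d" using e K by (simp add: d_def)
    obtain N where N: "\<And>n. n \<ge> N \<Longrightarrow> \<mu> n < d"
      using LIMSEQ_D[OF mu(3) d] mu(1) by auto
    have "\<exists>b. (\<forall>n. norm (b n) \<le> ?M) \<and>
        vnorm X (R x \<ominus>\<^bsub>X\<^esub> finsum X (\<lambda>n. b n \<odot>\<^bsub>X\<^esub> A (unit_seq n)) {..<N}) < e"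
      if x: "x \<in> unit_ball E" for x
    proof -
      obtain a where a: "a \<in> carrier (seqsp q)" "vnorm (seqsp q) a \<le> c" "R x = A (diag \<mu> a)"
        using fac[OF x] by blast
      have la: "lseq q (\<lambda>n. norm (a n))" using a by (simp add: seqsp_simps)
      let ?b = "diag \<mu> a"
      have bc: "?b \<in> carrier (seqsp q)" using diag_contraction(1)[OF q mu(1,2) la] by (simp add: seqsp_simps)
      have bM: "norm (?b n) \<le> ?M" for n
      proof -
        have "norm (?b n) \<le> norm (a n)"
          using mu(1,2)[of n] by (simp add: diag_def norm_mult mult_left_le_one_le)
        also have "\<dots> \<le> vnorm (seqsp q) a" using lseq_le_norm[OF q la] by (simp add: seqsp_simps)
        finally show ?thesis using a(2) by simp
      qed
      let ?P = "\<lambda>i. if i < N then ?b i else 0"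
      have Pc: "?P \<in> carrier (seqsp q)"
        using q by (auto simp: seqsp_simps intro: lseq_finite_support[of q _ N])
      have "A ?P = finsum X (\<lambda>n. A (?b n \<odot>\<^bsub>seqsp q\<^esub> unit_seq n)) {..<N}"
        unfolding finsum_unit_seq[OF q, symmetric] 
        by (intro A.finsum A.E.smult_closed) (simp_all add: unit_seq_carrier[OF q])
      also have "\<dots> = finsum X (\<lambda>n. ?b n \<odot>\<^bsub>X\<^esub> A (unit_seq n)) {..<N}"
        by (simp add: A.smult unit_seq_carrier[OF q])
      finally have "R x \<ominus>\<^bsub>X\<^esub> finsum X (\<lambda>n. ?b n \<odot>\<^bsub>X\<^esub> A (unit_seq n)) {..<N} = A (?b \<ominus>\<^bsub>seqsp q\<^esub> ?P)"
        using a(3) A.minus[OF bc Pc] by simp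
      moreover have "?b \<ominus>\<^bsub>seqsp q\<^esub> ?P = diag (\<lambda>n. if n < N then 0 else \<mu> n) a"
        by (subst seqsp_minus[OF q bc Pc]) (auto simp: diag_def)
      moreover have "vnorm X (A (diag (\<lambda>n. if n < N then 0 else \<mu> n) a)) < e"
      proof -
        let ?t = "diag (\<lambda>n. if n < N then 0 else \<mu> n) a"
        have "0 \<le> (if n < N then 0 else \<mu> n)" "(if n < N then 0 else \<mu> n) \<le> d" for n
          using mu(1)[of n] N[of n] d by auto
        from diag_contraction[OF q this la] have t: "?t \<in> carrier (seqsp q)"
          "vnorm (seqsp q) ?t \<le> d * vnorm (seqsp q) a" by (auto simp: seqsp_simps)
        have "vnorm X (A ?t) \<le> op_norm (seqsp q) X A * vnorm (seqsp q) ?t" by (rule A.le_op_norm[OF t(1)])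
        also have "\<dots> \<le> (op_norm (seqsp q) X A + 1) * (d * (?M + 1))"
        proof (intro mult_mono)
          have "d * vnorm (seqsp q) a \<le> d * (?M + 1)" using a(2) d by (intro mult_left_mono) auto
          then show "vnorm (seqsp q) ?t \<le> d * (?M + 1)" using t(2) by simp
        qed (use A.op_norm_nonneg A.E.vnorm_nonneg[OF t(1)] in auto)
        also have "\<dots> = d * K" by (simp add: K_def)
        also have "\<dots> < e" using e K by (simp add: d_def)
        finally show ?thesis .
      qed
      ultimately show ?thesis using bM by (intro exI[of _ ?b]) simp
    qed
    note * = this
    show "\<exists>N v. (\<forall>n. v n \<in> carrier X) \<and> (\<forall>y\<in>R ` unit_ball E. \<exists>b. (\<forall>n. norm (b n) \<le> ?M) \<and>
        vnorm X (y \<ominus>\<^bsub>X\<^esub> finsum X (\<lambda>n. b n \<odot>\<^bsub>X\<^esub> v n) {..<N::nat}) < e)"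
      by (rule exI[of _ N], rule exI[of _ "\<lambda>n. A (unit_seq n)"]) (use * in \<open>auto simp: unit_seq_carrier[OF q]\<close>)
  qed
  then show ?thesis using R by (simp add: compact_operator_def)
qed

section \<open>The factorization\<close>

text \<open>The chosen representative depends only on the value of \<theta>, so it distinguishes
  exactly the cosets of the kernel. The injection \<open>j\<close> only transports it to the
  prescribed type.\<close>

lemma quotient_op_inj:
  assumes "bounded_op G F \<theta>" "banach_space G" "inj j"
  shows "quotient_op G F \<theta> (\<lambda>a. j (inv_into (carrier G) \<theta> (\<theta> a)))"
proof -
  interpret bounded_op G F \<theta> by fact
  show ?thesis
  proof (intro quotient_op.intro quotient_op_axioms.intro)
    show "bounded_op G F \<theta>" "banach_space G" by fact+
    show "j (inv_into (carrier G) \<theta> (\<theta> a)) = j (inv_into (carrier G) \<theta> (\<theta> b)) \<longleftrightarrow> \<theta> a = \<theta> b"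
      if "a \<in> carrier G" "b \<in> carrier G" for a b
      using assms(3) that by (metis f_inv_into_f imageI injD)
  qed
qed

lemma compact_factorization_exists:
  fixes E :: "('k::{real_normed_field,euclidean_space}, 'e) normed_module"
    and F :: "('k, 'f) normed_module"
  assumes p: "1 \<le> p" and E: "banach_space E" and F: "banach_space F"
    and T: "bounded_operator E F T"
    and card: "(UNIV :: real set) \<lesssim> (UNIV :: 'x set)" "(UNIV :: real set) \<lesssim> (UNIV :: 'y set)"
    and x: "x \<in> lp p F" "T ` unit_ball E \<subseteq> p_co p F x" and c: "1 < c"
  obtains X :: "('k, 'x) normed_module" and Y :: "('k, 'y) normed_module" and R T\<^sub>0 S
  where "compact_factorization p E F T X Y R T\<^sub>0 S"
    "op_norm E X R \<le> 1" "op_norm Y F S \<le> 1" "kappa p X Y T\<^sub>0 \<le> c * lp_norm p F x"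
proof -
  interpret E: banach_space E by fact
  interpret F: banach_space F by fact
  interpret T: bounded_op E F T by unfold_locales fact
  define q where "q = conj_exp p"
  have q: "1 \<le> q" using conj_exp(2)[OF p] by (simp add: q_def)
  \<comment> \<open>One factor \<open>d\<close> pays for splitting off the null sequence, the other
    for representatives in \<open>X\<close> that only nearly attain the quotient norm.\<close>
  define d where "d = sqrt c"
  have d: "1 < d" "d * d = c" using c by (auto simp: d_def)

  have xF: "x n \<in> carrier F" for n using x(1) F.lp_iff by blast
  define a where "a n = vnorm F (x n)" for n
  have a: "lseq p a" "lp_norm p F x = lseq_norm p a"
    using x(1) F.lp_iff[of x p] by (auto simp: a_def[abs_def] lp_norm_eq)
  obtain l where l: "\<And>n. 0 < l n" "\<And>n. l n \<le> 1" "l \<longlonglongrightarrow> 0"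
    "lseq p (\<lambda>n. a n / l n)" "lseq_norm p (\<lambda>n. a n / l n) \<le> d * lseq_norm p a"
    using lseq_factor_null[OF p a(1) d(1)] by blast
  define \<mu> where "\<mu> n = sqrt (l n)" for n
  define \<sigma> where "\<sigma> n = a n / l n" for n
  \<comment> \<open>Because \<open>inverse 0 = 0\<close>, this normalises \<open>x n\<close> where
    it is nonzero and gives 0 elsewhere.\<close>
  define v where "v n = of_real (inverse (a n)) \<odot>\<^bsub>F\<^esub> x n" for n
  have \<mu>: "\<And>n. 0 \<le> \<mu> n" "\<And>n. \<mu> n \<le> 1" "\<And>n. \<mu> n * \<mu> n = l n"
    using l(1,2) by (auto simp: \<mu>_def less_imp_le)
  have \<mu>0: "\<mu> \<longlonglongrightarrow> 0" unfolding \<mu>_def using tendsto_real_sqrt[OF l(3)] by simp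
  have \<sigma>: "lseq p \<sigma>" "lseq_norm p \<sigma> \<le> d * lp_norm p F x" "\<And>n. 0 \<le> \<sigma> n"
    using l(4,5) a lseq_nonneg[OF l(4)] by (auto simp: \<sigma>_def[abs_def])
  have v: "v n \<in> carrier F" "vnorm F (v n) \<le> 1" for n
  proof -
    show "v n \<in> carrier F" using xF by (simp add: v_def)
    have "vnorm F (v n) = inverse (a n) * a n"
      using xF lseq_nonneg[OF a(1), of n] by (simp add: v_def F.vnorm_smult norm_inverse a_def)
    then show "vnorm F (v n) \<le> 1" by (cases "a n = 0") simp_all
  qed
  have xv: "of_real (\<mu> n * \<sigma> n * \<mu> n) \<odot>\<^bsub>F\<^esub> v n = x n" for n
  proof (cases "a n = 0")
    case True
    then have "x n = \<zero>\<^bsub>F\<^esub>" using F.vnorm_eq_0[OF xF] by (simp add: a_def)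
    then show ?thesis by (simp add: v_def)
  next
    case False
    have "\<mu> n * \<sigma> n * \<mu> n = \<mu> n * \<mu> n * \<sigma> n" by simp
    also have "\<dots> = a n" unfolding \<mu>(3) \<sigma>_def using l(1)[of n] by simp
    finally have "of_real (\<mu> n * \<sigma> n * \<mu> n) * of_real (inverse (a n)) = (1 :: 'k)"
      using False by (simp flip: of_real_mult)
    then show ?thesis
      unfolding v_def
      using F.smult_assoc1[of "of_real (\<mu> n * \<sigma> n * \<mu> n)" "of_real (inverse (a n))" "x n"] xF F.smult_one
      by simp
  qed

  obtain \<theta>v where \<theta>v: "bounded_op (seqsp 1) F \<theta>v"
    "\<And>b. b \<in> carrier (seqsp 1) \<Longrightarrow> vnorm F (\<theta>v b) \<le> vnorm (seqsp 1) b"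
    "\<And>b. b \<in> carrier (seqsp 1) \<Longrightarrow> vsums F (\<lambda>n. b n \<odot>\<^bsub>F\<^esub> v n) (\<theta>v b)"
    by (rule series_op[OF F, of v, OF v]) (rule that; blast)
  have Dm: "bounded_op (seqsp r) (seqsp r :: ('k, nat \<Rightarrow> 'k) normed_module) (diag \<mu>)" if "1 \<le> r" for r
    using diag_contraction[OF that \<mu>(1,2)] by (intro diag_bounded_op[where C=1] that conjI)
  have Ds: "bounded_op (seqsp q) (seqsp 1 :: ('k, nat \<Rightarrow> 'k) normed_module) (diag \<sigma>)"
    using diag_Holder[OF p \<sigma>(1)] q unfolding q_def
    by (intro diag_bounded_op[where C="lseq_norm p \<sigma>"] conjI) simp_all
  interpret Dm1: bounded_op "seqsp 1" "seqsp 1" "diag \<mu> :: (nat \<Rightarrow> 'k) \<Rightarrow> _" by (rule Dm) simp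
  interpret Dmq: bounded_op "seqsp q" "seqsp q" "diag \<mu> :: (nat \<Rightarrow> 'k) \<Rightarrow> _" by (rule Dm[OF q])
  interpret Ds: bounded_op "seqsp q" "seqsp 1" "diag \<sigma> :: (nat \<Rightarrow> 'k) \<Rightarrow> _" by (rule Ds)
  have Dm_le: "vnorm (seqsp r) (diag \<mu> b) \<le> vnorm (seqsp r) b"
    if "1 \<le> r" "b \<in> carrier (seqsp r)" for r and b :: "nat \<Rightarrow> 'k"
    using diag_contraction(2)[OF that(1) \<mu>(1,2), of b] that(2) by (simp add: seqsp_simps)
  have Ds_le: "vnorm (seqsp 1) (diag \<sigma> b) \<le> lseq_norm p \<sigma> * vnorm (seqsp q) b"
    if "b \<in> carrier (seqsp q)" for b :: "nat \<Rightarrow> 'k"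
    using diag_Holder(2)[OF p \<sigma>(1), of b] that by (simp add: seqsp_simps q_def)

  \<comment> \<open>Their kernels are the ones divided out: \<theta>w holds what remains to be
    applied after \<open>T\<^sub>0\<close>, and \<theta>u what remains after
    \<open>R\<close>.\<close>
  define \<theta>w where "\<theta>w b = \<theta>v (diag \<mu> b)" for b :: "nat \<Rightarrow> 'k"
  define \<theta>u where "\<theta>u b = \<theta>w (diag \<sigma> b)" for b :: "nat \<Rightarrow> 'k"
  have \<theta>w: "bounded_op (seqsp 1) F \<theta>w"
    unfolding \<theta>w_def[abs_def] by (rule bounded_operator_comp[OF Dm1.bounded_op_axioms \<theta>v(1)])
  have \<theta>u: "bounded_op (seqsp q) F \<theta>u"
    unfolding \<theta>u_def[abs_def] by (rule bounded_operator_comp[OF Ds.bounded_op_axioms \<theta>w])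

  obtain jx :: "(nat \<Rightarrow> 'k) \<Rightarrow> 'x" where jx: "inj jx"
    using lepoll_trans[OF lepoll_sequences card(1)] by (auto simp: lepoll_def)
  obtain jy :: "(nat \<Rightarrow> 'k) \<Rightarrow> 'y" where jy: "inj jy"
    using lepoll_trans[OF lepoll_sequences card(2)] by (auto simp: lepoll_def)
  define Qu where "Qu b = jx (inv_into (carrier (seqsp q)) \<theta>u (\<theta>u b))" for b
  define Qw where "Qw b = jy (inv_into (carrier (seqsp 1)) \<theta>w (\<theta>w b))" for b
  interpret U: quotient_op "seqsp q" F \<theta>u Qu
    unfolding Qu_def[abs_def] by (rule quotient_op_inj[OF \<theta>u banach_space_seqsp[OF q] jx])
  interpret W: quotient_op "seqsp 1" F \<theta>w Qw
    unfolding Qw_def[abs_def] by (rule quotient_op_inj[OF \<theta>w banach_space_seqsp jy]) simp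

  have \<theta>w_le: "vnorm F (\<theta>w b) \<le> 1 * vnorm (seqsp 1) b" if "b \<in> carrier (seqsp 1)" for b
    unfolding \<theta>w_def using \<theta>v(2)[OF Dm1.closed[OF that]] Dm_le[OF _ that] by simp
  obtain S where S: "bounded_operator W.X F S" "\<And>b. b \<in> carrier (seqsp 1) \<Longrightarrow> S (Qw b) = \<theta>w b"
    "\<And>y. y \<in> carrier W.X \<Longrightarrow> vnorm F (S y) \<le> 1 * vnorm W.X y"
    by (rule W.lift[OF \<theta>w \<theta>w_le zero_le_one]) (assumption | (rule that; blast))+

  \<comment> \<open>This map induces \<open>T\<^sub>0\<close>. It factors through the first quotient
    since \<theta>u is \<theta>w after \<open>diag \<sigma>\<close>, so equal values of \<theta>u
    give equal classes under \<open>Qw\<close>.\<close>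
  have B: "bounded_op (seqsp q) W.X (\<lambda>b. Qw (diag \<sigma> b))"
    by (rule bounded_operator_comp[OF Ds.bounded_op_axioms W.Q.bounded_op_axioms])
  have B_le: "vnorm W.X (Qw (diag \<sigma> b)) \<le> lseq_norm p \<sigma> * vnorm (seqsp q) b" if "b \<in> carrier (seqsp q)" for b
    using W.vnorm_Q_le[OF Ds.closed[OF that]] Ds_le[OF that] by simp
  obtain T\<^sub>0 where T0: "bounded_operator U.X W.X T\<^sub>0"
    "\<And>b. b \<in> carrier (seqsp q) \<Longrightarrow> T\<^sub>0 (Qu b) = Qw (diag \<sigma> b)"
  proof (rule U.lift[OF B B_le lseq_norm_nonneg[OF \<sigma>(1)]])
    show "Qw (diag \<sigma> b) = Qw (diag \<sigma> b')"
      if "b \<in> carrier (seqsp q)" "b' \<in> carrier (seqsp q)" "\<theta>u b = \<theta>u b'" for b b'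
      using that W.Q_eq_iff by (simp add: \<theta>u_def)
  qed auto

  \<comment> \<open>Of the factors in \<open>xv\<close>, one \<mu> is moved to the coefficients,
    while \<sigma> and the other \<mu> are already part of \<theta>u. Thus \<open>R z\<close> is the
    class of \<open>diag \<mu> \<alpha>\<close> with \<alpha> in the unit ball, which yields the
    compactness of \<open>R\<close>.\<close>
  have rep: "\<exists>\<alpha>\<in>carrier (seqsp q). vnorm (seqsp q) \<alpha> \<le> 1 \<and> \<theta>u (diag \<mu> \<alpha>) = T z"
    if z: "z \<in> unit_ball E" for z
  proof -
    obtain \<alpha> where \<alpha>: "\<alpha> \<in> lp q (scalars :: ('k, 'k) normed_module)"
      "lp_norm q (scalars :: ('k, 'k) normed_module) \<alpha> \<le> 1"
      "vsums F (\<lambda>n. \<alpha> n \<odot>\<^bsub>F\<^esub> x n) (T z)"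
      using x(2) z unfolding p_co_def q_def by blast
    have \<alpha>c: "\<alpha> \<in> carrier (seqsp q)" "vnorm (seqsp q) \<alpha> \<le> 1"
      using \<alpha>(1,2) by (simp_all add: seqsp_def)
    let ?b = "diag \<mu> (diag \<sigma> (diag \<mu> \<alpha>))"
    have b: "?b \<in> carrier (seqsp 1)" using \<alpha>c by simp
    have "?b n \<odot>\<^bsub>F\<^esub> v n = \<alpha> n \<odot>\<^bsub>F\<^esub> x n" for n
    proof -
      have "?b n = \<alpha> n * of_real (\<mu> n * \<sigma> n * \<mu> n)" by (simp add: diag_def mult_ac)
      then show ?thesis
        using F.smult_assoc1[of "\<alpha> n" "of_real (\<mu> n * \<sigma> n * \<mu> n)" "v n"] v xv[of n] by simp
    qed
    then have "\<theta>v ?b = T z" using \<theta>v(3)[OF b] \<alpha>(3) F.vsums_unique by simp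
    then show ?thesis using \<alpha>c by (intro bexI[of _ \<alpha>]) (simp_all add: \<theta>u_def \<theta>w_def)
  qed
  have rep': "\<exists>b\<in>carrier (seqsp q). \<theta>u b = T z \<and> vnorm (seqsp q) b \<le> 1" if z: "z \<in> unit_ball E" for z
    using rep[OF z] Dm_le[OF q] by (meson Dmq.closed order_trans)
  obtain R where R: "bounded_operator E U.X R"
    "\<And>z b. z \<in> carrier E \<Longrightarrow> b \<in> carrier (seqsp q) \<Longrightarrow> \<theta>u b = T z \<Longrightarrow> R z = Qu b"
    "\<And>z. z \<in> carrier E \<Longrightarrow> \<exists>b\<in>carrier (seqsp q). \<theta>u b = T z \<and> vnorm (seqsp q) b \<le> 1 * vnorm E z"
    by (rule U.colift[OF T.bounded_op_axioms rep']) (assumption | (rule that; blast))+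
  interpret R: bounded_op E U.X R by unfold_locales (rule R(1))
  interpret S: bounded_op W.X F S by unfold_locales (rule S(1))
  interpret T0: bounded_op U.X W.X T\<^sub>0 by unfold_locales (rule T0(1))

  have "T z = S (T\<^sub>0 (R z))" if z: "z \<in> carrier E" for z
  proof -
    obtain b where b: "b \<in> carrier (seqsp q)" "\<theta>u b = T z" using R(3)[OF z] by blast
    then show ?thesis using R(2)[OF z b] T0(2)[OF b(1)] S(2)[OF Ds.closed[OF b(1)]] by (simp add: \<theta>u_def)
  qed
  moreover have "compact_operator E U.X R"
  proof (rule compact_operator_through_diag[OF q U.banach_space_X U.Q.bounded_op_axioms R(1) \<mu>(1,2) \<mu>0, where c=1])
    fix z assume z: "z \<in> unit_ball E"
    then have zE: "z \<in> carrier E" by (simp add: unit_ball_def)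
    show "\<exists>b\<in>carrier (seqsp q). vnorm (seqsp q) b \<le> 1 \<and> R z = Qu (diag \<mu> b)"
      using rep[OF z] R(2)[OF zE Dmq.closed] by blast
  qed
  \<comment> \<open>An element of the unit ball of the quotient need not have a representative of
    norm at most 1, but it has one of norm below 2; hence \<open>c=2\<close>.\<close>
  moreover have "compact_operator W.X F S"
  proof (rule compact_operator_through_diag[OF _ F \<theta>v(1) S(1) \<mu>(1,2) \<mu>0, where c=2])
    fix y assume y: "y \<in> unit_ball W.X"
    then obtain b where b: "b \<in> carrier (seqsp 1)" "Qw b = y" "vnorm (seqsp 1) b < vnorm W.X y + 1"
      using W.obtain_repr[of y 1] by (auto simp: unit_ball_def)
    then show "\<exists>b\<in>carrier (seqsp 1). vnorm (seqsp 1) b \<le> 2 \<and> S y = \<theta>v (diag \<mu> b)"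
      using y S(2)[OF b(1)] by (intro bexI[of _ b]) (auto simp: unit_ball_def \<theta>w_def)
  qed simp
  moreover
  \<comment> \<open>A class in the unit ball has a representative \<open>b\<close> of norm less than
    \<open>d\<close>. The factor \<open>d\<close> put on \<open>y\<close> allows the coefficients
    \<open>b n / d\<close>, which lie in the unit ball.\<close>
  define y where "y n = of_real (d * \<sigma> n) \<odot>\<^bsub>W.X\<^esub> Qw (unit_seq n)" for n
  have uc: "unit_seq n \<in> carrier (seqsp 1 :: ('k, nat \<Rightarrow> 'k) normed_module)" for n
    by (rule unit_seq_carrier) simp
  have y: "y n \<in> carrier W.X" "vnorm W.X (y n) \<le> d * \<sigma> n" for n
  proof -
    show "y n \<in> carrier W.X"
      unfolding y_def by (intro W.X.smult_closed W.Q_closed uc) simp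
    have "vnorm (seqsp 1) (unit_seq n :: nat \<Rightarrow> 'k) \<le> 1" using unit_seq_norm(2) by (simp add: seqsp_simps)
    then have "vnorm W.X (Qw (unit_seq n)) \<le> 1" using W.vnorm_Q_le[OF uc[of n]] by simp
    then have "d * \<sigma> n * vnorm W.X (Qw (unit_seq n)) \<le> d * \<sigma> n * 1"
      using d \<sigma>(3)[of n] by (intro mult_left_mono) auto
    then show "vnorm W.X (y n) \<le> d * \<sigma> n"
      unfolding y_def using d \<sigma>(3)[of n] by (subst W.X.vnorm_smult[OF W.Q_closed[OF uc]]) (simp add: norm_mult)
  qed
  have ylp: "y \<in> lp p W.X" "lp_norm p W.X y \<le> c * lp_norm p F x"
  proof -
    have "0 \<le> d" using d by simp
    note sc = lseq_scale[OF p \<sigma>(1) this]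
    note mono = lseq_mono[OF p sc(1), of "\<lambda>n. vnorm W.X (y n)", OF W.X.vnorm_nonneg[OF y(1)] y(2)]
    show "y \<in> lp p W.X" using mono(1) y(1) W.X.lp_iff by blast
    have "lp_norm p W.X y \<le> d * lseq_norm p \<sigma>" using mono(2) sc(2) by (simp add: lp_norm_eq)
    also have "\<dots> \<le> d * (d * lp_norm p F x)" using \<sigma>(2) d by (intro mult_left_mono) auto
    finally show "lp_norm p W.X y \<le> c * lp_norm p F x" by (simp add: d(2) flip: mult.assoc)
  qed
  have pco: "T\<^sub>0 ` unit_ball U.X \<subseteq> p_co p W.X y"
  proof
    fix w assume "w \<in> T\<^sub>0 ` unit_ball U.X"
    then obtain z where z: "z \<in> carrier U.X" "vnorm U.X z \<le> 1" "w = T\<^sub>0 z" by (auto simp: unit_ball_def)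
    obtain b where b: "b \<in> carrier (seqsp q)" "Qu b = z" "vnorm (seqsp q) b < vnorm U.X z + (d - 1)"
      using U.obtain_repr[OF z(1), of "d - 1"] d by auto
    have wb: "w = Qw (diag \<sigma> b)" using z(3) b T0(2) by auto
    have "vsums (seqsp 1) (\<lambda>n. diag \<sigma> b n \<odot>\<^bsub>seqsp 1\<^esub> unit_seq n) (diag \<sigma> b)"
      by (rule vsums_unit_seq[OF Ds.closed[OF b(1)]])
    then have "vsums W.X (\<lambda>n. Qw (diag \<sigma> b n \<odot>\<^bsub>seqsp 1\<^esub> unit_seq n)) w"
      unfolding wb by (intro W.Q.vsums Dm1.E.smult_closed uc) simp_all
    moreover have "Qw (diag \<sigma> b n \<odot>\<^bsub>seqsp 1\<^esub> unit_seq n) = (of_real (inverse d) * b n) \<odot>\<^bsub>W.X\<^esub> y n" for n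
    proof -
      have "diag \<sigma> b n = of_real (inverse d) * b n * of_real (d * \<sigma> n)"
        using d by (simp add: diag_def mult_ac)
      then show ?thesis
        unfolding y_def W.Q_smult[OF uc, symmetric]
        using W.X.smult_assoc1[of "of_real (inverse d) * b n" "of_real (d * \<sigma> n)" "Qw (unit_seq n)"] uc
        by simp
    qed
    ultimately have vs: "vsums W.X (\<lambda>n. (of_real (inverse d) * b n) \<odot>\<^bsub>W.X\<^esub> y n) w" by simp
    have sc: "of_real (inverse d) \<odot>\<^bsub>seqsp q\<^esub> b \<in> carrier (seqsp q)"
      using b(1) by (intro Dmq.E.smult_closed) simp_all
    have "vnorm (seqsp q) (of_real (inverse d) \<odot>\<^bsub>seqsp q\<^esub> b) = vnorm (seqsp q) b / d"
      using Dmq.E.vnorm_smult[OF b(1)] d by (simp add: norm_inverse divide_inverse mult.commute)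
    also have "\<dots> \<le> 1" using b(3) z(2) d by (simp add: divide_le_eq_1)
    finally show "w \<in> p_co p W.X y"
      using sc vs unfolding p_co_def q_def[symmetric]
      by (auto simp: seqsp_def intro!: bexI[of _ "\<lambda>n. of_real (inverse d) * b n"])
  qed
  have "p_compact_operator p U.X W.X T\<^sub>0"
    using T0(1) ylp(1) pco by (auto simp: p_compact_operator_def)
  ultimately have "compact_factorization p E F T U.X W.X R T\<^sub>0 S"
    using U.banach_space_X W.banach_space_X by (simp add: compact_factorization_def)
  moreover have "op_norm E U.X R \<le> 1"
  proof (rule R.op_norm_le)
    fix z assume z: "z \<in> carrier E"
    then obtain b where b: "b \<in> carrier (seqsp q)" "\<theta>u b = T z" "vnorm (seqsp q) b \<le> 1 * vnorm E z"
      using R(3) by blast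
    then show "vnorm U.X (R z) \<le> 1 * vnorm E z"
      using R(2)[OF z b(1,2)] U.vnorm_Q_le[OF b(1)] by simp
  qed simp
  moreover have "op_norm W.X F S \<le> 1" by (rule S.op_norm_le[OF S(3)]) simp_all
  moreover have "kappa p U.X W.X T\<^sub>0 \<le> c * lp_norm p F x"
    using kappa_le[OF W.X.normed_space_axioms ylp(1) pco] ylp(2) by simp
  ultimately show thesis using that by blast
qed

(* The intermediate spaces X and Y have carriers in 'x and 'y. These types are arbitrary
   apart from having at least the cardinality of the continuum, so every Banach space is
   covered by some instance of the theorem. *)
theorem proposition2p9:
  fixes E :: "('k::{real_normed_field,euclidean_space}, 'e) normed_module"
    and F :: "('k, 'f) normed_module"
    and T :: "'e \<Rightarrow> 'f"
    and p :: ereal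
  assumes "1 \<le> p"
    and "banach_space E" and "banach_space F"
    and "bounded_operator E F T"
    and "(UNIV :: real set) \<lesssim> (UNIV :: 'x set)"
    and "(UNIV :: real set) \<lesssim> (UNIV :: 'y set)"
  shows "(p_compact_operator p E F T \<longleftrightarrow>
      (\<exists>(X :: ('k, 'x) normed_module) (Y :: ('k, 'y) normed_module) R T\<^sub>0 S.
         compact_factorization p E F T X Y R T\<^sub>0 S)) \<and>
    (p_compact_operator p E F T \<longrightarrow>
      kappa p E F T =
        Inf {op_norm Y F S * kappa p X Y T\<^sub>0 * op_norm E X R
             | (X :: ('k, 'x) normed_module) (Y :: ('k, 'y) normed_module) R T\<^sub>0 S.
               compact_factorization p E F T X Y R T\<^sub>0 S})"
proof -
  interpret E: banach_space E by fact
  interpret F: banach_space F by fact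
  let ?P = "{op_norm Y F S * kappa p X Y T\<^sub>0 * op_norm E X R
    | (X :: ('k, 'x) normed_module) (Y :: ('k, 'y) normed_module) R T\<^sub>0 S.
      compact_factorization p E F T X Y R T\<^sub>0 S}"
  have forward: "\<exists>t\<in>?P. t \<le> c * lp_norm p F x"
    if x: "x \<in> lp p F" "T ` unit_ball E \<subseteq> p_co p F x" and c: "1 < c" for x c
  proof -
    obtain X :: "('k, 'x) normed_module" and Y :: "('k, 'y) normed_module" and R T\<^sub>0 S
      where fac: "compact_factorization p E F T X Y R T\<^sub>0 S" and
      le: "op_norm E X R \<le> 1" "op_norm Y F S \<le> 1" "kappa p X Y T\<^sub>0 \<le> c * lp_norm p F x"
      by (rule compact_factorization_exists[OF assms x c])
    interpret X: banach_space X using fac by (simp add: compact_factorization_def)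
    interpret Y: banach_space Y using fac by (simp add: compact_factorization_def)
    interpret R: bounded_op E X R
      by unfold_locales (use fac in \<open>simp add: compact_factorization_def compact_operator_def\<close>)
    interpret S: bounded_op Y F S
      by unfold_locales (use fac in \<open>simp add: compact_factorization_def compact_operator_def\<close>)
    have k: "0 \<le> kappa p X Y T\<^sub>0"
      by (rule kappa_nonneg[OF _ Y.normed_space_axioms]) (use fac in \<open>simp add: compact_factorization_def\<close>)
    \<comment> \<open>The outer norms are at most 1, so the product costs no more than the middle
      operator.\<close>
    have "op_norm Y F S * kappa p X Y T\<^sub>0 * op_norm E X R \<le> 1 * kappa p X Y T\<^sub>0 * 1"
      using le k R.op_norm_nonneg S.op_norm_nonneg by (intro mult_mono mult_nonneg_nonneg) auto
    moreover have "op_norm Y F S * kappa p X Y T\<^sub>0 * op_norm E X R \<in> ?P" using fac by blast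
    ultimately show ?thesis using le(3) by (intro bexI) simp_all
  qed
  have backward: "p_compact_operator p E F T \<and>
      kappa p E F T \<le> op_norm Y F S * kappa p X Y T\<^sub>0 * op_norm E X R"
    if fac: "compact_factorization p E F T X Y R T\<^sub>0 S"
    for X :: "('k, 'x) normed_module" and Y :: "('k, 'y) normed_module" and R T\<^sub>0 S
  proof -
    interpret X: banach_space X using fac by (simp add: compact_factorization_def)
    interpret Y: banach_space Y using fac by (simp add: compact_factorization_def)
    interpret R: bounded_op E X R
      by unfold_locales (use fac in \<open>simp add: compact_factorization_def compact_operator_def\<close>)
    interpret S: bounded_op Y F S
      by unfold_locales (use fac in \<open>simp add: compact_factorization_def compact_operator_def\<close>)
    have T0: "p_compact_operator p X Y T\<^sub>0" using fac by (simp add: compact_factorization_def)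
    interpret T0: bounded_op X Y T\<^sub>0
      by unfold_locales (use T0 in \<open>simp add: p_compact_operator_def\<close>)
    have im: "T ` unit_ball E = (\<lambda>z. S (T\<^sub>0 (R z))) ` unit_ball E"
      by (rule image_cong) (use fac in \<open>auto simp: compact_factorization_def unit_ball_def\<close>)
    \<comment> \<open>The infimum \<open>kappa\<close> need not be attained, so the ideal property
      is applied with every \<open>t\<close> strictly above it.\<close>
    have ex: "\<exists>y\<in>lp p F. T ` unit_ball E \<subseteq> p_co p F y \<and> lp_norm p F y \<le> op_norm Y F S * t * op_norm E X R"
      if t: "kappa p X Y T\<^sub>0 < t" for t
    proof -
      obtain x where x: "x \<in> lp p Y" "T\<^sub>0 ` unit_ball X \<subseteq> p_co p Y x" "lp_norm p Y x < t"
        using kappa_less[OF T0 Y.normed_space_axioms t] by blast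
      obtain y where y: "y \<in> lp p F" "(\<lambda>v. S (T\<^sub>0 (R v))) ` unit_ball E \<subseteq> p_co p F y"
        "lp_norm p F y \<le> op_norm Y F S * lp_norm p Y x * op_norm E X R"
        using p_compact_comp[OF R.bounded_op_axioms T0.bounded_op_axioms S.bounded_op_axioms assms(1) x(2,1)]
        by blast
      have "op_norm Y F S * lp_norm p Y x * op_norm E X R \<le> op_norm Y F S * t * op_norm E X R"
        using x(3) R.op_norm_nonneg S.op_norm_nonneg by (intro mult_right_mono mult_left_mono) auto
      then show ?thesis using y im by (intro bexI[of _ y]) auto
    qed
    have "p_compact_operator p E F T"
      using ex[of "kappa p X Y T\<^sub>0 + 1"] assms(4) by (auto simp: p_compact_operator_def)
    moreover have "kappa p E F T \<le> op_norm Y F S * kappa p X Y T\<^sub>0 * op_norm E X R"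
    proof (rule field_le_epsilon)
      fix e :: real assume e: "0 < e"
      \<comment> \<open>The summand 1 keeps the divisor positive when an outer operator vanishes;
        the error is then at most \<open>(?m - 1) * (e / ?m)\<close>, hence at most
        \<open>e\<close>.\<close>
      let ?m = "op_norm Y F S * op_norm E X R + 1"
      have m: "0 < ?m" using R.op_norm_nonneg S.op_norm_nonneg by (simp add: add_nonneg_pos)
      let ?t = "kappa p X Y T\<^sub>0 + e / ?m"
      obtain y where y: "y \<in> lp p F" "T ` unit_ball E \<subseteq> p_co p F y"
        "lp_norm p F y \<le> op_norm Y F S * ?t * op_norm E X R"
        using ex[of ?t] e m by auto
      have "kappa p E F T \<le> op_norm Y F S * ?t * op_norm E X R"
        using kappa_le[OF F.normed_space_axioms y(1,2)] y(3) by simp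
      also have "\<dots> = op_norm Y F S * kappa p X Y T\<^sub>0 * op_norm E X R + (?m - 1) * (e / ?m)"
        by (simp add: algebra_simps)
      also have "(?m - 1) * (e / ?m) \<le> ?m * (e / ?m)"
        using e m by (intro mult_right_mono) auto
      also have "?m * (e / ?m) = e" using m by simp
      finally show "kappa p E F T \<le> op_norm Y F S * kappa p X Y T\<^sub>0 * op_norm E X R + e" by simp
    qed
    ultimately show ?thesis ..
  qed
  have iff: "p_compact_operator p E F T \<longleftrightarrow>
      (\<exists>(X :: ('k, 'x) normed_module) (Y :: ('k, 'y) normed_module) R T\<^sub>0 S.
         compact_factorization p E F T X Y R T\<^sub>0 S)"
  proof
    assume "p_compact_operator p E F T"
    then obtain x where x: "x \<in> lp p F" "T ` unit_ball E \<subseteq> p_co p F x"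
      by (auto simp: p_compact_operator_def)
    have "\<exists>t\<in>?P. t \<le> 2 * lp_norm p F x" by (rule forward[OF x]) simp
    then obtain t where "t \<in> ?P" "t \<le> 2 * lp_norm p F x" by (rule bexE)
    then show "\<exists>(X :: ('k, 'x) normed_module) (Y :: ('k, 'y) normed_module) R T\<^sub>0 S.
         compact_factorization p E F T X Y R T\<^sub>0 S" by blast
  qed (use backward in blast)
  have "kappa p E F T = Inf ?P" if pc: "p_compact_operator p E F T"
  proof (rule antisym)
    have ne: "?P \<noteq> {}" using iff pc by auto
    show "kappa p E F T \<le> Inf ?P"
      by (rule cInf_greatest[OF ne]) (use backward in auto)
    have bdd: "bdd_below ?P"
      by (rule bdd_belowI[of _ "kappa p E F T"]) (use backward in auto)
    show "Inf ?P \<le> kappa p E F T"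
      unfolding kappa_def[of p E F T]
    proof (rule cInf_greatest)
      show "{lp_norm p F x |x. x \<in> lp p F \<and> T ` unit_ball E \<subseteq> p_co p F x} \<noteq> {}"
        using pc by (auto simp: p_compact_operator_def)
      fix N assume "N \<in> {lp_norm p F x |x. x \<in> lp p F \<and> T ` unit_ball E \<subseteq> p_co p F x}"
      then obtain x where x: "N = lp_norm p F x" "x \<in> lp p F" "T ` unit_ball E \<subseteq> p_co p F x" by auto
      show "Inf ?P \<le> N"
      \<comment> \<open>The constant c = 1/z with 0 < z < 1 is taken arbitrarily close to 1. The
        multiplicative form matches \<open>forward\<close> and includes the case N = 0.\<close>
      proof (rule field_le_mult_one_interval)
        fix z :: real assume z: "0 < z" "z < 1"
        have "\<exists>t\<in>?P. t \<le> inverse z * lp_norm p F x"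
          by (rule forward[OF x(2,3)]) (use z in \<open>simp add: one_less_inverse\<close>)
        then obtain t where t: "t \<in> ?P" "t \<le> inverse z * N"
          unfolding x(1) by (rule bexE)
        have "Inf ?P \<le> inverse z * N" using cInf_lower[OF t(1) bdd] t(2) by linarith
        then show "z * Inf ?P \<le> N" using z by (simp add: field_simps)
      qed
    qed
  qed
  then show ?thesis using iff by blast
qed

end
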